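(* Consider the Gaussian sequence model with $n\to\infty$, $s_n\to\infty$, $n/s_n\to\infty$. For $b\in\mathbb{R}$ let $a_b=\sqrt{2\log(n/s_n)}+b$ and $$\Theta_b=\{\theta\in\mathbb{R}^n:\ |S_\theta|=s_n,\ |\theta_i|\ge a_b\ \text{for all } i\in S_\theta\}.$$ Then for any fixed $b\in\mathbb{R}$, $$\inf_{\varphi}\ \sup_{\theta\in\Theta_b}\ \mathfrak{R}(\theta,\varphi)=\overline{\Phi}(b)+o(1),$$ where the infimum is over all multiple testing procedures. The result also holds in the limiting cases $b=b_n\to+\infty$ and $b=b_n\to-\infty$ (where $\overline\Phi(b_n)\to 0$ and $\overline\Phi(b_n)\to1$, respectively).
   Context: Model: for each $n$, one observes $X=(X_1,\dots,X_n)$ with $X_i=\theta_i+\varepsilon_i$, $\varepsilon_i$ i.i.d. $\mathcal N(0,1)$, with $\theta\in\mathbb{R}^n$ deterministic; $P_\theta,E_\theta$ denote the law of $X$ and its expectation. $S_\theta=\{i:\theta_i\ne0\}$. $(s_n)$ is a sequence of integers with $1\le s_n\le n$. $\overline\Phi(x)=P(\mathcal N(0,1)>x)$. A multiple testing procedure is a measurable map $\varphi:\mathbb{R}^n\to\{0,1\}^n$ (possibly depending on $n$, $s_n$). Its risks at $\theta$ are $$\mathrm{FDR}(\theta,\varphi)=E_\theta\left[\frac{\sum_{i}\mathbf 1\{\theta_i=0\}\varphi_i(X)}{1\vee\sum_i\varphi_i(X)}\right],\quad \mathrm{FNR}(\theta,\varphi)=E_\theta\left[\frac{\sum_i\mathbf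 1\{\theta_i\neq0\}(1-\varphi_i(X))}{1\vee\sum_i\mathbf 1\{\theta_i\ne0\}}\right],$$ and $\mathfrak R(\theta,\varphi)=\mathrm{FDR}(\theta,\varphi)+\mathrm{FNR}(\theta,\varphi)$. *)

theory Defs
  imports "HOL-Probability.Probability" "HOL-Library.Landau_Symbols"
begin

text \<open>Vectors in \<open>\<real>\<^sup>n\<close> are extensional functions on the index set \<open>{..<n}\<close>,
  i.e. coordinates are numbered from 0 and set to \<^term>\<open>undefined\<close> outside it.\<close>

abbreviation Rn :: "nat \<Rightarrow> (nat \<Rightarrow> real) measure" where
  "Rn n \<equiv> PiM {..<n} (\<lambda>_. borel)"

definition noise :: "nat \<Rightarrow> (nat \<Rightarrow> real) measure" where
  "noise n = PiM {..<n} (\<lambda>_. std_normal_distribution)"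

definition obs_law :: "nat \<Rightarrow> (nat \<Rightarrow> real) \<Rightarrow> (nat \<Rightarrow> real) measure" where
  "obs_law n \<theta> = distr (noise n) (Rn n) (\<lambda>\<epsilon>. \<lambda>i\<in>{..<n}. \<theta> i + \<epsilon> i)"

definition Phi_bar :: "real \<Rightarrow> real" where
  "Phi_bar x = measure std_normal_distribution {x<..}"

definition supp :: "nat \<Rightarrow> (nat \<Rightarrow> real) \<Rightarrow> nat set" where
  "supp n \<theta> = {i \<in> {..<n}. \<theta> i \<noteq> 0}"

definition procedures :: "nat \<Rightarrow> ((nat \<Rightarrow> real) \<Rightarrow> nat \<Rightarrow> real) set" where
  "procedures n = measurable (Rn n) (PiM {..<n} (\<lambda>_. count_space {0, 1}))"

definition FDR :: "nat \<Rightarrow> (nat \<Rightarrow> real) \<Rightarrow> ((nat \<Rightarrow> real) \<Rightarrow> nat \<Rightarrow> real) \<Rightarrow> real" where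
  "FDR n \<theta> \<phi> = (\<integral>x. (\<Sum>i<n. of_bool (\<theta> i = 0) * \<phi> x i) / max 1 (\<Sum>i<n. \<phi> x i) \<partial>obs_law n \<theta>)"

definition FNR :: "nat \<Rightarrow> (nat \<Rightarrow> real) \<Rightarrow> ((nat \<Rightarrow> real) \<Rightarrow> nat \<Rightarrow> real) \<Rightarrow> real" where
  "FNR n \<theta> \<phi> = (\<integral>x. (\<Sum>i<n. of_bool (\<theta> i \<noteq> 0) * (1 - \<phi> x i)) /
                     max 1 (\<Sum>i<n. of_bool (\<theta> i \<noteq> 0)) \<partial>obs_law n \<theta>)"

definition risk :: "nat \<Rightarrow> (nat \<Rightarrow> real) \<Rightarrow> ((nat \<Rightarrow> real) \<Rightarrow> nat \<Rightarrow> real) \<Rightarrow> real" where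
  "risk n \<theta> \<phi> = FDR n \<theta> \<phi> + FNR n \<theta> \<phi>"

definition signal_bound :: "nat \<Rightarrow> nat \<Rightarrow> real \<Rightarrow> real" where
  "signal_bound n s b = sqrt (2 * ln (real n / real s)) + b"

definition Theta :: "nat \<Rightarrow> nat \<Rightarrow> real \<Rightarrow> (nat \<Rightarrow> real) set" where
  "Theta n s b = {\<theta> \<in> space (Rn n). card (supp n \<theta>) = s \<and>
                    (\<forall>i\<in>supp n \<theta>. \<bar>\<theta> i\<bar> \<ge> signal_bound n s b)}"

text \<open>For \<open>s \<le> n\<close> the infimum and suprema below are over nonempty sets of reals
  bounded in \<open>[0, 2]\<close>, so they are the usual ones; see the lemmas that follow.\<close>

definition minimax_risk :: "nat \<Rightarrow> nat \<Rightarrow> real \<Rightarrow> real" where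
  "minimax_risk n s b = (INF \<phi>\<in>procedures n. SUP \<theta>\<in>Theta n s b. risk n \<theta> \<phi>)"

lemma Theta_nonempty:
  assumes "s \<le> n"
  shows "Theta n s b \<noteq> {}"
proof -
  define c where "c = max 1 (signal_bound n s b)"
  define \<theta> where "\<theta> = (\<lambda>i\<in>{..<n}. if i < s then c else (0::real))"
  have "supp n \<theta> = {..<s}"
    using assms by (auto simp: supp_def \<theta>_def c_def)
  then have "\<theta> \<in> Theta n s b"
    using assms by (auto simp: Theta_def space_PiM \<theta>_def c_def)
  then show ?thesis by blast
qed

lemma procedures_nonempty: "procedures n \<noteq> {}"
proof -
  have "(\<lambda>x. \<lambda>i\<in>{..<n}. 0) \<in> procedures n"
    unfolding procedures_def by (intro measurable_restrict) auto
  then show ?thesis by blast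
qed

lemma procedure_values:
  assumes "\<phi> \<in> procedures n" "x \<in> space (Rn n)" "i < n"
  shows "\<phi> x i \<in> {0, 1}"
proof -
  have "\<phi> x \<in> space (PiM {..<n} (\<lambda>_. count_space {0, 1::real}))"
    by (rule measurable_space[OF assms(1)[unfolded procedures_def] assms(2)])
  then show ?thesis using assms(3) by (auto simp: space_PiM)
qed

lemma prob_space_obs_law: "prob_space (obs_law n \<theta>)"
proof -
  interpret N: prob_space std_normal_distribution
    by (rule prob_space_normal_density) simp
  interpret product_prob_space "\<lambda>_. std_normal_distribution" "{..<n}" ..
  have P: "prob_space (noise n)"
    unfolding noise_def by (rule P.prob_space_axioms)
  have "(\<lambda>\<epsilon>. \<lambda>i\<in>{..<n}. \<theta> i + \<epsilon> i) \<in> measurable (noise n) (Rn n)"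
    unfolding noise_def
    by measurable
  then show ?thesis
    unfolding obs_law_def by (rule prob_space.prob_space_distr[OF P])
qed

lemma integral_in_unit_interval:
  assumes "prob_space M" "\<And>x. x \<in> space M \<Longrightarrow> 0 \<le> f x \<and> f x \<le> (1::real)"
  shows "0 \<le> integral\<^sup>L M f" "integral\<^sup>L M f \<le> 1"
proof -
  interpret prob_space M by fact
  show "0 \<le> integral\<^sup>L M f"
    by (rule Bochner_Integration.integral_nonneg) (use assms(2) in auto)
  show "integral\<^sup>L M f \<le> 1"
  proof (cases "integrable M f")
    case True
    then have "integral\<^sup>L M f \<le> integral\<^sup>L M (\<lambda>_. 1)"
      by (intro integral_mono) (use assms(2) in auto)
    then show ?thesis by (simp add: prob_space)
  next
    case False
    then show ?thesis by (simp add: not_integrable_integral_eq)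
  qed
qed

lemma risk_bounds:
  assumes "\<phi> \<in> procedures n"
  shows "0 \<le> risk n \<theta> \<phi>" "risk n \<theta> \<phi> \<le> 2"
proof -
  have v: "0 \<le> \<phi> x i \<and> \<phi> x i \<le> 1" if "x \<in> space (obs_law n \<theta>)" "i < n" for x i
    using procedure_values[OF assms, of x i] that by (auto simp: obs_law_def)
  have ratio: "0 \<le> a / max 1 c \<and> a / max 1 c \<le> 1" if "0 \<le> a" "a \<le> c" for a c :: real
    using that by (auto simp: divide_simps)
  have fdr: "0 \<le> FDR n \<theta> \<phi>" "FDR n \<theta> \<phi> \<le> 1"
  proof -
    have *: "0 \<le> (\<Sum>i<n. of_bool (\<theta> i = 0) * \<phi> x i) / max 1 (\<Sum>i<n. \<phi> x i) \<and>
        (\<Sum>i<n. of_bool (\<theta> i = 0) * \<phi> x i) / max 1 (\<Sum>i<n. \<phi> x i) \<le> 1"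
      if x: "x \<in> space (obs_law n \<theta>)" for x
    proof (rule ratio)
      show "0 \<le> (\<Sum>i<n. of_bool (\<theta> i = 0) * \<phi> x i)"
        by (rule sum_nonneg) (simp add: v[OF x])
      show "(\<Sum>i<n. of_bool (\<theta> i = 0) * \<phi> x i) \<le> (\<Sum>i<n. \<phi> x i)"
        by (rule sum_mono) (simp add: v[OF x])
    qed
    show "0 \<le> FDR n \<theta> \<phi>" "FDR n \<theta> \<phi> \<le> 1"
      unfolding FDR_def using integral_in_unit_interval[OF prob_space_obs_law *] by auto
  qed
  have fnr: "0 \<le> FNR n \<theta> \<phi>" "FNR n \<theta> \<phi> \<le> 1"
  proof -
    let ?d = "\<Sum>i<n. of_bool (\<theta> i \<noteq> 0) :: real"
    have *: "0 \<le> (\<Sum>i<n. of_bool (\<theta> i \<noteq> 0) * (1 - \<phi> x i)) / max 1 ?d \<and>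
        (\<Sum>i<n. of_bool (\<theta> i \<noteq> 0) * (1 - \<phi> x i)) / max 1 ?d \<le> 1"
      if x: "x \<in> space (obs_law n \<theta>)" for x
    proof (rule ratio)
      show "0 \<le> (\<Sum>i<n. of_bool (\<theta> i \<noteq> 0) * (1 - \<phi> x i))"
        by (rule sum_nonneg) (simp add: v[OF x])
      show "(\<Sum>i<n. of_bool (\<theta> i \<noteq> 0) * (1 - \<phi> x i)) \<le> ?d"
        by (rule sum_mono) (simp add: v[OF x])
    qed
    show "0 \<le> FNR n \<theta> \<phi>" "FNR n \<theta> \<phi> \<le> 1"
      unfolding FNR_def using integral_in_unit_interval[OF prob_space_obs_law *] by auto
  qed
  show "0 \<le> risk n \<theta> \<phi>" "risk n \<theta> \<phi> \<le> 2"
    using fdr fnr by (auto simp: risk_def)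
qed

end

theory Submission
  imports Defs "HOL-Real_Asymp.Real_Asymp"
begin

text \<open>
  Write \<open>\<alpha> = sqrt (2 * ln (n / s))\<close>.

  Upper bound: reject when \<open>\<bar>x i\<bar> > \<alpha> + d\<close>, with \<open>d > 0\<close> fixed. A signal is missed with probability
  at most \<open>Phi_bar (b - d)\<close>. The expected number of false discoveries is at most
  \<open>2 * n * exp (- (\<alpha> + d)\<^sup>2 / 2) \<le> 2 * s * exp (- d * \<alpha>)\<close>, negligible against the number of true
  discoveries, which is of order \<open>s\<close> by Hoeffding's inequality.

  Lower bound: put one signal of size \<open>a = \<alpha> + b\<close> at a uniformly random place of each of \<open>s\<close> blocks
  of length \<open>n div s\<close>. Up to a loss \<open>l\<close>, the risk dominates a linear loss in which a false discovery
  costs \<open>l / s\<close>, so that the blocks decouple. Within a block, under the null some coordinate other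
  than \<open>i\<close> exceeds \<open>\<alpha> - c\<close> with high probability. Then a discovery at \<open>i\<close> pays off only if
  \<open>x i > \<alpha> - c + ln l / a\<close>, which under a signal at \<open>i\<close> has probability close to
  \<open>Phi_bar (- b - c)\<close>.

  The cases \<open>b n \<longlonglongrightarrow> \<plusminus>\<infinity>\<close> follow because the minimax risk is antimonotone in \<open>b\<close>.
\<close>

section \<open>The Gaussian tail\<close>

abbreviation gauss :: "real \<Rightarrow> real measure" where
  "gauss \<mu> \<equiv> density lborel (\<lambda>x. ennreal (normal_density \<mu> 1 x))"

lemma prob_space_gauss: "prob_space (gauss \<mu>)"
  by (rule prob_space_normal_density) simp

lemma distr_gauss_add: "distr (gauss 0) borel (\<lambda>x. \<mu> + x) = gauss \<mu>"
proof -
  interpret prob_space "gauss 0" by (rule prob_space_gauss)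
  have "distributed (gauss 0) lborel (\<lambda>x. x) (normal_density 0 1)"
    by (auto simp: distributed_def distr_id2)
  from normal_density_affine[OF this, of 1 \<mu>]
  have "distributed (gauss 0) lborel (\<lambda>x. \<mu> + x) (normal_density \<mu> 1)" by simp
  then have "distr (gauss 0) lborel (\<lambda>x. \<mu> + x) = gauss \<mu>"
    by (simp add: distributed_def)
  also have "distr (gauss 0) lborel (\<lambda>x. \<mu> + x) = distr (gauss 0) borel (\<lambda>x. \<mu> + x)"
    by (rule distr_cong) auto
  finally show ?thesis .
qed

lemma distr_gauss_uminus: "distr (gauss 0) borel uminus = gauss 0"
proof -
  interpret prob_space "gauss 0" by (rule prob_space_gauss)
  have "distributed (gauss 0) lborel (\<lambda>x. x) (normal_density 0 1)"
    by (auto simp: distributed_def distr_id2)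
  from normal_density_affine[OF this, of "-1" 0]
  have "distributed (gauss 0) lborel uminus (normal_density 0 1)" by simp
  then have "distr (gauss 0) lborel uminus = gauss 0"
    by (simp add: distributed_def)
  also have "distr (gauss 0) lborel uminus = distr (gauss 0) borel uminus"
    by (rule distr_cong) auto
  finally show ?thesis .
qed

lemma measure_gauss_eq:
  assumes "A \<in> sets borel"
  shows "measure (gauss \<mu>) A = measure (gauss 0) {x. \<mu> + x \<in> A}"
  using assms by (subst distr_gauss_add[symmetric]) (simp add: measure_distr vimage_def)

lemma measure_gauss_greaterThan: "measure (gauss \<mu>) {t<..} = Phi_bar (t - \<mu>)"
  by (subst measure_gauss_eq)
     (auto simp: Phi_bar_def greaterThan_def intro!: arg_cong[of _ _ "measure _"])

lemma measure_gauss_eq_integral: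
  assumes [measurable]: "A \<in> sets borel"
  shows "measure (gauss \<mu>) A = (\<integral>x. normal_density \<mu> 1 x * indicator A x \<partial>lborel)"
proof -
  have "emeasure (gauss \<mu>) A = (\<integral>\<^sup>+x. ennreal (normal_density \<mu> 1 x * indicator A x) \<partial>lborel)"
    by (subst emeasure_density) (auto intro!: nn_integral_cong simp: indicator_def)
  also have "\<dots> = ennreal (\<integral>x. normal_density \<mu> 1 x * indicator A x \<partial>lborel)"
    by (rule nn_integral_eq_integral) (auto intro!: integrable_real_mult_indicator)
  finally show ?thesis
    by (simp add: measure_def)
qed

text \<open>The density never exceeds 1, because sqrt(2 pi) is at least 1. The crude constant is
  good enough for a Lipschitz bound on \<open>Phi_bar\<close>.\<close>

lemma measure_gauss_le_measure_lborel:
  assumes "a \<le> b"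
  shows "measure (gauss \<mu>) {a<..b} \<le> b - a"
proof -
  have "normal_density \<mu> 1 x \<le> 1" for x
  proof -
    have "1 \<le> sqrt (2 * pi)" using pi_gt3 by simp
    then have "exp (- (x - \<mu>)\<^sup>2 / 2) / sqrt (2 * pi) \<le> 1 / 1"
      by (intro frac_le) auto
    then show ?thesis by (simp add: normal_density_def)
  qed
  then have "(\<integral>x. normal_density \<mu> 1 x * indicator {a<..b} x \<partial>lborel)
     \<le> (\<integral>x. indicator {a<..b} x \<partial>lborel)"
    using assms
    by (intro integral_mono) (auto intro!: integrable_real_mult_indicator split: split_indicator)
  then show ?thesis using assms by (subst measure_gauss_eq_integral) simp_all
qed

lemma measure_gauss_singleton: "measure (gauss \<mu>) {a} = 0"
proof -
  have "AE x in lborel. x \<noteq> a" by (rule AE_lborel_singleton)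
  then have "emeasure (gauss \<mu>) {a} = 0"
    by (subst emeasure_density)
       (auto intro!: nn_integral_zero' elim!: eventually_mono)
  then show ?thesis by (simp add: measure_def)
qed

lemma measure_gauss_atLeast: "measure (gauss \<mu>) {t..} = Phi_bar (t - \<mu>)"
proof -
  interpret prob_space "gauss \<mu>" by (rule prob_space_gauss)
  have "{t..} = insert t {t<..}" by auto
  then have "measure (gauss \<mu>) {t..} = measure (gauss \<mu>) {t} + measure (gauss \<mu>) {t<..}"
    by (subst finite_measure_Union[symmetric]) auto
  then show ?thesis by (simp add: measure_gauss_singleton measure_gauss_greaterThan)
qed

lemma Phi_bar_nonneg: "0 \<le> Phi_bar x" and Phi_bar_le_1: "Phi_bar x \<le> 1"
proof -
  interpret prob_space "gauss 0" by (rule prob_space_gauss)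
  show "0 \<le> Phi_bar x" "Phi_bar x \<le> 1" by (auto simp: Phi_bar_def)
qed

lemma Phi_bar_diff:
  assumes "x \<le> y"
  shows "Phi_bar x = measure (gauss 0) {x<..y} + Phi_bar y"
proof -
  interpret prob_space "gauss 0" by (rule prob_space_gauss)
  have "{x<..} = {x<..y} \<union> {y<..}" using assms by auto
  then show ?thesis unfolding Phi_bar_def by (simp add: finite_measure_Union disjoint_iff)
qed

lemma Phi_bar_antimono: "x \<le> y \<Longrightarrow> Phi_bar y \<le> Phi_bar x"
  using Phi_bar_diff[of x y] by simp

text \<open>Absorbs the small threshold shifts: \<open>d\<close> in the upper bound,
  \<open>c - ln c / (\<alpha> + b)\<close> in the lower bound.\<close>

lemma Phi_bar_lipschitz: "x \<le> y \<Longrightarrow> Phi_bar x \<le> Phi_bar y + (y - x)"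
  using Phi_bar_diff[of x y] measure_gauss_le_measure_lborel[of x y 0] by simp

lemma measure_gauss_lessThan: "measure (gauss \<mu>) {..<t} = 1 - Phi_bar (t - \<mu>)"
proof -
  interpret prob_space "gauss \<mu>" by (rule prob_space_gauss)
  have "{..<t} = space (gauss \<mu>) - {t..}" by auto
  then show ?thesis using prob_compl[of "{t..}"] by (simp add: measure_gauss_atLeast)
qed

lemma measure_gauss_atMost: "measure (gauss \<mu>) {..t} = 1 - Phi_bar (t - \<mu>)"
proof -
  interpret prob_space "gauss \<mu>" by (rule prob_space_gauss)
  have "{..t} = space (gauss \<mu>) - {t<..}" by auto
  then show ?thesis using prob_compl[of "{t<..}"] by (simp add: measure_gauss_greaterThan)
qed

lemma Phi_bar_minus: "Phi_bar (- x) = 1 - Phi_bar x"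
proof -
  have "Phi_bar (-x) = measure (distr (gauss 0) borel uminus) {-x<..}"
    by (simp add: distr_gauss_uminus Phi_bar_def)
  also have "\<dots> = measure (gauss 0) {..<x}"
    by (subst measure_distr) (auto intro!: arg_cong[of _ _ "measure _"])
  finally show ?thesis by (simp add: measure_gauss_lessThan)
qed

text \<open>For x > t >= 0 one has x^2 >= t^2 + (x - t)^2. Hence on the tail the standard density is
  at most exp(-t^2/2) times the density centred at t, which has total mass 1.\<close>

lemma Phi_bar_le_exp:
  assumes "0 \<le> t"
  shows "Phi_bar t \<le> exp (- t\<^sup>2 / 2)"
proof -
  have "Phi_bar t = (\<integral>x. normal_density 0 1 x * indicator {t<..} x \<partial>lborel)"
    by (simp add: Phi_bar_def measure_gauss_eq_integral)
  also have "\<dots> \<le> (\<integral>x. exp (- t\<^sup>2 / 2) * normal_density t 1 x \<partial>lborel)"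
  proof (intro integral_mono integrable_real_mult_indicator)
    fix x
    show "normal_density 0 1 x * indicator {t<..} x \<le> exp (- t\<^sup>2 / 2) * normal_density t 1 x"
    proof (cases "t < x")
      case True
      then have "t * t \<le> t * x" using assms by (intro mult_left_mono) auto
      then have "- x\<^sup>2 / 2 \<le> - t\<^sup>2 / 2 + - (x - t)\<^sup>2 / 2"
        by (simp add: power2_eq_square algebra_simps)
      then have "exp (- x\<^sup>2 / 2) \<le> exp (- t\<^sup>2 / 2) * exp (- (x - t)\<^sup>2 / 2)"
        by (simp flip: exp_add)
      then show ?thesis using True
        by (simp add: normal_density_def divide_right_mono)
    qed (simp add: normal_density_nonneg)
  qed auto
  also have "\<dots> = exp (- t\<^sup>2 / 2)" by simp
  finally show ?thesis .
qed

text \<open>The tail contains a window of width \<open>d\<close>, on which the density is smallest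
  at the right end. In the lower bound the window stays a fixed distance below
  \<open>\<alpha>\<close>, so that \<open>n / s\<close> times this quantity diverges.\<close>

lemma Phi_bar_ge_density:
  assumes "0 \<le> t" "0 \<le> d"
  shows "d * std_normal_density (t + d) \<le> Phi_bar t"
proof -
  have "d * std_normal_density (t + d) = (\<integral>x. std_normal_density (t + d) * indicator {t<..t+d} x \<partial>lborel)"
    using assms by simp
  also have "\<dots> \<le> (\<integral>x. normal_density 0 1 x * indicator {t<..t+d} x \<partial>lborel)"
  proof (intro integral_mono)
    fix x
    show "std_normal_density (t + d) * indicator {t<..t+d} x
          \<le> std_normal_density x * indicator {t<..t+d} x"
    proof (cases "t < x \<and> x \<le> t + d")
      case True
      then have "x\<^sup>2 \<le> (t + d)\<^sup>2" using assms by (intro power_mono) auto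
      then show ?thesis using True by (simp add: std_normal_density_def divide_right_mono)
    qed auto
  qed (use assms in \<open>auto intro!: integrable_real_mult_indicator\<close>)
  also have "\<dots> = measure (gauss 0) {t<..t+d}"
    by (simp add: measure_gauss_eq_integral)
  also have "\<dots> \<le> Phi_bar t"
    using Phi_bar_diff[of t "t + d"] assms Phi_bar_nonneg[of "t + d"] by simp
  finally show ?thesis .
qed

lemma Phi_bar_at_top: "(Phi_bar \<longlongrightarrow> 0) at_top"
proof (rule tendsto_sandwich[OF _ _ tendsto_const])
  show "\<forall>\<^sub>F x in at_top. Phi_bar x \<le> exp (- x\<^sup>2 / 2)"
    using eventually_ge_at_top[of 0] by eventually_elim (rule Phi_bar_le_exp)
  show "((\<lambda>x::real. exp (- x\<^sup>2 / 2)) \<longlongrightarrow> 0) at_top" by real_asymp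
  show "\<forall>\<^sub>F x in at_top. 0 \<le> Phi_bar x" by (simp add: Phi_bar_nonneg)
qed

lemma Phi_bar_at_bot: "(Phi_bar \<longlongrightarrow> 1) at_bot"
proof -
  have "((\<lambda>x. 1 - Phi_bar (- x)) \<longlongrightarrow> 1 - 0) at_bot"
    by (intro tendsto_intros filterlim_compose[OF Phi_bar_at_top filterlim_uminus_at_top_at_bot])
  then show ?thesis by (simp add: Phi_bar_minus)
qed

lemma Phi_bar_pos: "0 < Phi_bar x"
proof -
  let ?t = "max x 0"
  have "0 < 1 * std_normal_density (?t + 1)" by (simp add: normal_density_pos)
  also have "\<dots> \<le> Phi_bar ?t" by (rule Phi_bar_ge_density) auto
  also have "\<dots> \<le> Phi_bar x" by (rule Phi_bar_antimono) auto
  finally show ?thesis .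
qed

section \<open>The law of the observations\<close>

lemma sets_obs_law [simp, measurable_cong]: "sets (obs_law n \<theta>) = sets (Rn n)"
  and space_obs_law [simp]: "space (obs_law n \<theta>) = space (Rn n)"
  by (simp_all add: obs_law_def)

lemma product_prob_space_gauss: "product_prob_space (\<lambda>i. gauss (\<theta> i))"
  unfolding product_prob_space_def product_prob_space_axioms_def product_sigma_finite_def
  by (auto intro!: prob_space_gauss prob_space_imp_sigma_finite)

text \<open>A product measure is determined by its values on rectangles, and there the shift acts on
  each factor separately. This form makes independence and one-coordinate changes of measure
  available.\<close>

lemma obs_law_eq_PiM: "obs_law n \<theta> = PiM {..<n} (\<lambda>i. gauss (\<theta> i))"
proof -
  interpret G: product_prob_space "\<lambda>i. gauss (\<theta> i)" "{..<n}" by (rule product_prob_space_gauss)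
  interpret N: product_prob_space "\<lambda>i. gauss 0" "{..<n}" by (rule product_prob_space_gauss)
  show ?thesis
  proof (rule G.PiM_eqI)
    show "sets (obs_law n \<theta>) = sets (PiM {..<n} (\<lambda>i. gauss (\<theta> i)))"
      unfolding sets_obs_law by (intro sets_PiM_cong) auto
    fix A :: "nat \<Rightarrow> real set" assume "\<And>i. i \<in> {..<n} \<Longrightarrow> A i \<in> sets (gauss (\<theta> i))"
    then have A [measurable]: "\<And>i. i \<in> {..<n} \<Longrightarrow> A i \<in> sets borel" by simp
    have [measurable]: "(\<lambda>\<epsilon>. \<lambda>i\<in>{..<n}. \<theta> i + \<epsilon> i) \<in> measurable (noise n) (Rn n)"
      unfolding noise_def by measurable
    have "emeasure (obs_law n \<theta>) (Pi\<^sub>E {..<n} A)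
        = emeasure (noise n) ((\<lambda>\<epsilon>. \<lambda>i\<in>{..<n}. \<theta> i + \<epsilon> i) -` (Pi\<^sub>E {..<n} A) \<inter> space (noise n))"
      unfolding obs_law_def by (intro emeasure_distr sets_PiM_I_finite) auto
    also have "(\<lambda>\<epsilon>. \<lambda>i\<in>{..<n}. \<theta> i + \<epsilon> i) -` (Pi\<^sub>E {..<n} A) \<inter> space (noise n)
        = Pi\<^sub>E {..<n} (\<lambda>i. (+) (\<theta> i) -` A i)"
      by (auto simp: noise_def space_PiM PiE_def Pi_def)
    also have "emeasure (noise n) \<dots> = (\<Prod>i<n. emeasure (gauss 0) ((+) (\<theta> i) -` A i))"
      unfolding noise_def by (intro N.emeasure_PiM) (auto intro!: measurable_sets_borel[OF _ A])
    also have "\<dots> = (\<Prod>i<n. emeasure (gauss (\<theta> i)) (A i))"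
    proof (intro prod.cong refl)
      fix i assume "i \<in> {..<n}"
      then show "emeasure (gauss 0) ((+) (\<theta> i) -` A i) = emeasure (gauss (\<theta> i)) (A i)"
        by (subst (2) distr_gauss_add[symmetric]) (simp add: emeasure_distr A)
    qed
    finally show "emeasure (obs_law n \<theta>) (Pi\<^sub>E {..<n} A) = (\<Prod>i<n. emeasure (gauss (\<theta> i)) (A i))" .
  qed simp
qed

lemma measure_obs_law_rectangle:
  assumes "J \<subseteq> {..<n}" "\<And>j. j \<in> J \<Longrightarrow> A j \<in> sets borel"
  shows "measure (obs_law n \<theta>) {x \<in> space (Rn n). \<forall>j\<in>J. x j \<in> A j} = (\<Prod>j\<in>J. measure (gauss (\<theta> j)) (A j))"
proof -
  interpret product_prob_space "\<lambda>i. gauss (\<theta> i)" "{..<n}" by (rule product_prob_space_gauss)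
  interpret G: prob_space "gauss m" for m by (rule prob_space_gauss)
  interpret O: prob_space "obs_law n \<theta>" by (rule prob_space_obs_law)
  have "space (Rn n) = space (PiM {..<n} (\<lambda>i. gauss (\<theta> i)))" by (simp add: space_PiM)
  moreover have "finite J" using assms(1) finite_subset by blast
  ultimately have "emeasure (obs_law n \<theta>) {x \<in> space (Rn n). \<forall>j\<in>J. x j \<in> A j}
      = (\<Prod>j\<in>J. emeasure (gauss (\<theta> j)) (A j))"
    using assms by (simp add: obs_law_eq_PiM emeasure_PiM_Collect)
  then show ?thesis
    by (simp add: O.emeasure_eq_measure G.emeasure_eq_measure prod_ennreal prod_nonneg)
qed

lemma measure_obs_law_coordinate:
  assumes "i < n" "A \<in> sets borel"
  shows "measure (obs_law n \<theta>) {x \<in> space (Rn n). x i \<in> A} = measure (gauss (\<theta> i)) A"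
  using measure_obs_law_rectangle[of "{i}" n "\<lambda>_. A" \<theta>] assms by simp

section \<open>Change of measure in one coordinate\<close>

text \<open>The likelihood ratio of N(a,1) against N(0,1) at the point \<open>y\<close>.\<close>

definition tilt :: "real \<Rightarrow> real \<Rightarrow> real" where
  "tilt a y = exp (a * y - a\<^sup>2 / 2)"

lemma tilt_pos: "0 < tilt a y"
  by (simp add: tilt_def)

lemma borel_measurable_tilt [measurable]: "tilt a \<in> borel_measurable borel"
  unfolding tilt_def by measurable

lemma tilt_gauss: "density (gauss 0) (\<lambda>y. ennreal (tilt a y)) = gauss a"
proof -
  have "normal_density 0 1 y * tilt a y = normal_density a 1 y" for y
    by (simp add: normal_density_def tilt_def power2_eq_square field_simps flip: exp_add)
  then show ?thesis
    by (simp add: density_density_eq tilt_pos less_imp_le flip: ennreal_mult)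
qed

text \<open>By independence, a signal placed at a null coordinate alters only one factor of the
  product, so the likelihood ratio depends on \<open>x i\<close> alone. Different positions of a
  signal thus become comparable under one common law.\<close>

lemma obs_law_upd_eq_density:
  assumes "i < n" "\<theta> i = 0"
  shows "obs_law n (\<theta>(i := a)) = density (obs_law n \<theta>) (\<lambda>x. ennreal (tilt a (x i)))"
proof -
  interpret G: product_prob_space "\<lambda>j. gauss ((\<theta>(i := a)) j)" "{..<n}" by (rule product_prob_space_gauss)
  interpret N: product_prob_space "\<lambda>j. gauss (\<theta> j)" "{..<n}" by (rule product_prob_space_gauss)
  have "density (obs_law n \<theta>) (\<lambda>x. ennreal (tilt a (x i))) = PiM {..<n} (\<lambda>j. gauss ((\<theta>(i := a)) j))"
  proof (rule G.PiM_eqI)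
    show "sets (density (obs_law n \<theta>) (\<lambda>x. ennreal (tilt a (x i)))) = sets (PiM {..<n} (\<lambda>j. gauss ((\<theta>(i := a)) j)))"
      unfolding sets_density sets_obs_law by (intro sets_PiM_cong) auto
    fix A :: "nat \<Rightarrow> real set" assume "\<And>j. j \<in> {..<n} \<Longrightarrow> A j \<in> sets (gauss ((\<theta>(i := a)) j))"
    then have A: "\<And>j. j \<in> {..<n} \<Longrightarrow> A j \<in> sets borel" by simp
    have [measurable]: "Pi\<^sub>E {..<n} A \<in> sets (Rn n)"
      using A by (intro sets_PiM_I_finite) auto
    have [measurable]: "(\<lambda>x. x i) \<in> measurable (Rn n) borel"
      using assms by (intro measurable_component_singleton) auto
    \<comment> \<open>The tilt is put into factor \<open>i\<close>, so that the integrand is a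
      product over coordinates and the integral factorizes.\<close>
    define f where "f = (\<lambda>j y. (if j = i then ennreal (tilt a y) else 1) * indicator (A j) y)"
    have f: "f j \<in> borel_measurable borel" if "j \<in> {..<n}" for j
      using A[OF that] unfolding f_def by measurable
    have "emeasure (density (obs_law n \<theta>) (\<lambda>x. ennreal (tilt a (x i)))) (Pi\<^sub>E {..<n} A)
       = (\<integral>\<^sup>+x. ennreal (tilt a (x i)) * indicator (Pi\<^sub>E {..<n} A) x \<partial>obs_law n \<theta>)"
      by (rule emeasure_density) auto
    also have "\<dots> = (\<integral>\<^sup>+x. (\<Prod>j<n. f j (x j)) \<partial>obs_law n \<theta>)"
    proof (intro nn_integral_cong)
      fix x assume "x \<in> space (obs_law n \<theta>)"
      then have "indicator (Pi\<^sub>E {..<n} A) x = (\<Prod>j<n. indicator (A j) (x j) :: ennreal)"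
        by (auto simp: space_PiM PiE_def Pi_def indicator_def prod_zero_iff)
      then show "ennreal (tilt a (x i)) * indicator (Pi\<^sub>E {..<n} A) x = (\<Prod>j<n. f j (x j))"
        using assms by (simp add: f_def prod.distrib prod.delta)
    qed
    also have "\<dots> = (\<Prod>j<n. \<integral>\<^sup>+y. f j y \<partial>gauss (\<theta> j))"
      unfolding obs_law_eq_PiM using f by (intro N.product_nn_integral_prod) auto
    also have "\<dots> = (\<Prod>j<n. emeasure (gauss ((\<theta>(i := a)) j)) (A j))"
    proof (intro prod.cong refl)
      fix j assume j: "j \<in> {..<n}"
      note [measurable] = A[OF j]
      show "(\<integral>\<^sup>+y. f j y \<partial>gauss (\<theta> j)) = emeasure (gauss ((\<theta>(i := a)) j)) (A j)"
      proof (cases "j = i")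
        case True
        have "(\<integral>\<^sup>+y. f j y \<partial>gauss 0) = emeasure (density (gauss 0) (\<lambda>y. ennreal (tilt a y))) (A j)"
          using True A[OF j] by (subst emeasure_density) (simp_all add: f_def)
        then show ?thesis using assms True by (simp add: tilt_gauss)
      next
        case False
        then show ?thesis using A[OF j] by (simp add: f_def)
      qed
    qed
    finally show "emeasure (density (obs_law n \<theta>) (\<lambda>x. ennreal (tilt a (x i)))) (Pi\<^sub>E {..<n} A)
       = (\<Prod>j<n. emeasure (gauss ((\<theta>(i := a)) j)) (A j))" .
  qed simp
  then show ?thesis by (simp only: obs_law_eq_PiM)
qed

text \<open>The tilt itself is unbounded; integrability comes from the boundedness of
  \<open>g\<close> under the shifted law, whose density the tilt is.\<close>

lemma
  fixes g :: "(nat \<Rightarrow> real) \<Rightarrow> real"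
  assumes "i < n" "\<theta> i = 0" and [measurable]: "g \<in> borel_measurable (Rn n)"
    and bd: "\<And>x. x \<in> space (Rn n) \<Longrightarrow> \<bar>g x\<bar> \<le> 1"
  shows integral_obs_law_upd: "(\<integral>x. g x \<partial>obs_law n (\<theta>(i := a))) = (\<integral>x. tilt a (x i) * g x \<partial>obs_law n \<theta>)"
    and integrable_tilt: "integrable (obs_law n \<theta>) (\<lambda>x. tilt a (x i) * g x)"
proof -
  have [measurable]: "(\<lambda>x. x i) \<in> measurable (Rn n) borel"
    using assms by (intro measurable_component_singleton) auto
  interpret P: prob_space "obs_law n (\<theta>(i := a))" by (rule prob_space_obs_law)
  have "integrable (obs_law n (\<theta>(i := a))) g"
    using bd by (intro P.integrable_const_bound[where B = 1]) auto
  then show "integrable (obs_law n \<theta>) (\<lambda>x. tilt a (x i) * g x)"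
    by (simp add: obs_law_upd_eq_density[of i n \<theta> a, OF assms(1,2)] integrable_density tilt_pos less_imp_le)
  show "(\<integral>x. g x \<partial>obs_law n (\<theta>(i := a))) = (\<integral>x. tilt a (x i) * g x \<partial>obs_law n \<theta>)"
    by (simp add: obs_law_upd_eq_density[of i n \<theta> a, OF assms(1,2)] integral_density tilt_pos less_imp_le)
qed

text \<open>If some other coordinate of the block exceeds \<open>T\<close> while \<open>x i\<close> stays below
  \<open>T + ln l / a\<close>, then moving the signal to that coordinate multiplies the likelihood by at least
  \<open>1 / l\<close>; a discovery at \<open>i\<close> then costs more than it gains.\<close>

lemma block_discovery_bound:
  fixes g :: "(nat \<Rightarrow> real) \<Rightarrow> real"
  assumes I: "I \<subseteq> {..<n}" "i \<in> I" "\<And>j. j \<in> I \<Longrightarrow> \<theta> j = 0"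
    and a: "0 < a" and l: "0 < l"
    and [measurable]: "g \<in> borel_measurable (Rn n)"
    and g: "\<And>x. x \<in> space (Rn n) \<Longrightarrow> 0 \<le> g x \<and> g x \<le> 1"
  shows "(\<integral>x. g x \<partial>obs_law n (\<theta>(i := a))) - l * (\<Sum>j\<in>I-{i}. \<integral>x. g x \<partial>obs_law n (\<theta>(j := a)))
    \<le> (1 - Phi_bar T) ^ (card I - 1) + Phi_bar (T + ln l / a - a)"
proof -
  have fin: "finite I" using I finite_subset by blast
  have [measurable]: "(\<lambda>x. x j) \<in> measurable (Rn n) borel" if "j \<in> I" for j
    using I that by (intro measurable_component_singleton) auto
  \<comment> \<open>Chosen so that \<open>a * T' = a * T + ln l\<close>: below \<open>T'\<close> the
    tilt at \<open>i\<close> is at most \<open>l\<close> times the tilt at any coordinate above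
    \<open>T\<close>.\<close>
  define T' where "T' = T + ln l / a"
  \<comment> \<open>\<open>u\<close> and \<open>v\<close> mark the two exceptional events: no other
    coordinate of the block exceeds \<open>T\<close>, or \<open>x i\<close> reaches
    \<open>T'\<close>. On these \<open>g\<close> is simply bounded by 1.\<close>
  define u where "u = (\<lambda>x::nat \<Rightarrow> real. indicator {x \<in> space (Rn n). \<forall>j\<in>I-{i}. x j \<in> {..T}} x :: real)"
  define v where "v = (\<lambda>x::nat \<Rightarrow> real. indicator {x \<in> space (Rn n). x i \<in> {T'..}} x :: real)"
  have meas_sets: "{x \<in> space (Rn n). \<forall>j\<in>I-{i}. x j \<in> {..T}} \<in> sets (Rn n)"
    "{x \<in> space (Rn n). x i \<in> {T'..}} \<in> sets (Rn n)"
    using fin I(2) by measurable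
  then have [measurable]: "u \<in> borel_measurable (Rn n)" "v \<in> borel_measurable (Rn n)"
    unfolding u_def v_def by measurable
  let ?M = "obs_law n \<theta>"
  have bd: "\<bar>g x\<bar> \<le> 1" "\<bar>u x\<bar> \<le> 1" "\<bar>v x\<bar> \<le> 1" if "x \<in> space (Rn n)" for x
    using g[OF that] by (auto simp: u_def v_def)
  have iI: "i < n" "\<theta> i = 0" using I by auto
  have jI: "j < n" "\<theta> j = 0" if "j \<in> I - {i}" for j using I that by auto
  note int = integrable_tilt[OF _ _ _ bd(1)] integrable_tilt[OF _ _ _ bd(2)] integrable_tilt[OF _ _ _ bd(3)]
  note upd = integral_obs_law_upd[OF _ _ _ bd(1)] integral_obs_law_upd[OF _ _ _ bd(2)] integral_obs_law_upd[OF _ _ _ bd(3)]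
  \<comment> \<open>A pointwise comparison under the law without a signal in the block. Off both
    exceptional events a single term of the last sum already dominates. Integrating turns each tilt
    back into a signal at the corresponding place.\<close>
  have key: "tilt a (x i) * g x \<le> tilt a (x i) * u x + tilt a (x i) * v x + (\<Sum>j\<in>I-{i}. l * (tilt a (x j) * g x))"
    if x: "x \<in> space (Rn n)" for x
  proof -
    have nn: "0 \<le> (\<Sum>j\<in>I-{i}. l * (tilt a (x j) * g x))"
      using l g[OF x] by (intro sum_nonneg) (auto intro!: mult_nonneg_nonneg simp: tilt_pos less_imp_le)
    consider "u x = 1" | "v x = 1" | "u x = 0" "v x = 0" by (auto simp: u_def v_def indicator_def)
    then show ?thesis
    proof cases
      case 3
      then have "\<not> (\<forall>j\<in>I-{i}. x j \<in> {..T})" and "\<not> x i \<in> {T'..}"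
        using x by (auto simp: u_def v_def indicator_def simp del: atMost_iff atLeast_iff)
      then obtain j where j: "j \<in> I - {i}" "x j > T" and xi: "x i < T'"
        by (auto simp: not_le)
      have "a * x i \<le> a * T'" using xi a by simp
      also have "\<dots> = a * T + ln l" using a by (simp add: T'_def field_simps)
      also have "\<dots> \<le> ln l + a * x j" using j a by simp
      finally have "tilt a (x i) \<le> exp (ln l) * tilt a (x j)"
        unfolding tilt_def exp_add[symmetric] by simp
      then have "tilt a (x i) * g x \<le> l * (tilt a (x j) * g x)"
        using l g[OF x] by (simp add: mult_right_mono flip: mult.assoc)
      also have "\<dots> \<le> (\<Sum>j\<in>I-{i}. l * (tilt a (x j) * g x))"
        using j fin l g[OF x]
        by (intro member_le_sum) (auto intro!: mult_nonneg_nonneg simp: tilt_pos less_imp_le)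
      finally show ?thesis using 3 by simp
    next
      case 1
      have "tilt a (x i) * g x \<le> tilt a (x i) * 1" using g[OF x] tilt_pos[of a "x i"] by (intro mult_left_mono) auto
      moreover have "0 \<le> tilt a (x i) * v x" using tilt_pos[of a "x i"] by (simp add: v_def)
      ultimately show ?thesis using 1 nn by simp
    next
      case 2
      have "tilt a (x i) * g x \<le> tilt a (x i) * 1" using g[OF x] tilt_pos[of a "x i"] by (intro mult_left_mono) auto
      moreover have "0 \<le> tilt a (x i) * u x" using tilt_pos[of a "x i"] by (simp add: u_def)
      ultimately show ?thesis using 2 nn by simp
    qed
  qed
  have "(\<integral>x. g x \<partial>obs_law n (\<theta>(i := a))) = (\<integral>x. tilt a (x i) * g x \<partial>?M)"
    by (rule upd) (use iI in auto)
  also have "\<dots> \<le> (\<integral>x. tilt a (x i) * u x + tilt a (x i) * v x + (\<Sum>j\<in>I-{i}. l * (tilt a (x j) * g x)) \<partial>?M)"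
    using iI jI by (intro integral_mono Bochner_Integration.integrable_add Bochner_Integration.integrable_sum integrable_mult_right int key) auto
  also have "\<dots> = (\<integral>x. tilt a (x i) * u x \<partial>?M) + (\<integral>x. tilt a (x i) * v x \<partial>?M)
      + (\<Sum>j\<in>I-{i}. l * (\<integral>x. tilt a (x j) * g x \<partial>?M))"
    using iI jI by (subst Bochner_Integration.integral_add Bochner_Integration.integral_sum integral_mult_right
       | intro Bochner_Integration.integrable_add Bochner_Integration.integrable_sum integrable_mult_right int | simp)+
  \<comment> \<open>With the signal at \<open>i\<close>, the other coordinates of the block are
    still null, so the probability that none exceeds \<open>T\<close> is a power; \<open>v\<close>
    sees only coordinate \<open>i\<close>, which has mean \<open>a\<close>.\<close>
  also have "(\<integral>x. tilt a (x i) * u x \<partial>?M) = (\<integral>x. u x \<partial>obs_law n (\<theta>(i := a)))"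
    by (rule upd[symmetric]) (use iI in auto)
  also have "\<dots> = measure (obs_law n (\<theta>(i := a))) {x \<in> space (Rn n). \<forall>j\<in>I-{i}. x j \<in> {..T}}"
    using meas_sets by (simp add: u_def Int_absorb2 sets.sets_into_space)
  also have "\<dots> = (\<Prod>j\<in>I-{i}. measure (gauss ((\<theta>(i := a)) j)) {..T})"
    using I by (intro measure_obs_law_rectangle) auto
  also have "\<dots> = (\<Prod>j\<in>I-{i}. 1 - Phi_bar T)"
    using I by (intro prod.cong) (auto simp: measure_gauss_atMost)
  also have "\<dots> = (1 - Phi_bar T) ^ (card I - 1)" using I by simp
  also have "(\<integral>x. tilt a (x i) * v x \<partial>?M) = (\<integral>x. v x \<partial>obs_law n (\<theta>(i := a)))"
    by (rule upd[symmetric]) (use iI in auto)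
  also have "\<dots> = measure (obs_law n (\<theta>(i := a))) {x \<in> space (Rn n). x i \<in> {T'..}}"
    using meas_sets by (simp add: v_def Int_absorb2 sets.sets_into_space)
  also have "\<dots> = Phi_bar (T' - a)"
    using iI by (subst measure_obs_law_coordinate) (auto simp: measure_gauss_atLeast)
  also have "(\<Sum>j\<in>I-{i}. l * (\<integral>x. tilt a (x j) * g x \<partial>?M)) = l * (\<Sum>j\<in>I-{i}. \<integral>x. g x \<partial>obs_law n (\<theta>(j := a)))"
    unfolding sum_distrib_left by (intro sum.cong refl arg_cong[of _ _ "times l"] upd[symmetric]) (use jI in auto)
  finally show ?thesis by (simp only: T'_def diff_le_eq)
qed

section \<open>Linearization and block configurations\<close>

lemma borel_measurable_procedure:
  assumes "\<phi> \<in> procedures n" "i < n"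
  shows "(\<lambda>x. \<phi> x i) \<in> borel_measurable (Rn n)"
proof -
  have "(\<lambda>x. \<phi> x i) \<in> measurable (Rn n) (count_space {0, 1})"
    using assms unfolding procedures_def by (intro measurable_compose[OF assms(1)[unfolded procedures_def] measurable_component_singleton]) auto
  moreover have "(\<lambda>x. x) \<in> measurable (count_space {0, 1}) (borel :: real measure)"
    by (simp add: measurable_count_space_eq1)
  ultimately show ?thesis by (rule measurable_compose)
qed

text \<open>The integrands of \<open>FDR\<close> and \<open>FNR\<close>, as functions of a decision
  vector. The inequalities between losses can then be proved pointwise, before integration.\<close>

definition FDP :: "nat \<Rightarrow> (nat \<Rightarrow> real) \<Rightarrow> (nat \<Rightarrow> real) \<Rightarrow> real" where
  "FDP n \<theta> d = (\<Sum>i<n. of_bool (\<theta> i = 0) * d i) / max 1 (\<Sum>i<n. d i)"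

definition FNP :: "nat \<Rightarrow> (nat \<Rightarrow> real) \<Rightarrow> (nat \<Rightarrow> real) \<Rightarrow> real" where
  "FNP n \<theta> d = (\<Sum>i<n. of_bool (\<theta> i \<noteq> 0) * (1 - d i)) / max 1 (\<Sum>i<n. of_bool (\<theta> i \<noteq> 0))"

lemma sum_of_bool_times:
  fixes n :: nat
  shows
  "(\<Sum>i<n. of_bool (P i) * f i :: real) = (\<Sum>i | i < n \<and> P i. f i)"
proof -
  have "(\<Sum>i<n. of_bool (P i) * f i) = (\<Sum>i<n. if P i then f i else 0)"
    by (intro sum.cong) auto
  also have "\<dots> = (\<Sum>i | i \<in> {..<n} \<and> P i. f i)"
    by (rule sum.inter_filter[symmetric]) simp
  finally show ?thesis by simp
qed

lemma FDP_eq: "FDP n \<theta> d = (\<Sum>i\<in>{..<n} - supp n \<theta>. d i) / max 1 ((\<Sum>i\<in>{..<n} - supp n \<theta>. d i) + (\<Sum>i\<in>supp n \<theta>. d i))"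
proof -
  have "{i. i < n \<and> \<theta> i = 0} = {..<n} - supp n \<theta>" by (auto simp: supp_def)
  moreover have "(\<Sum>i<n. d i) = (\<Sum>i\<in>{..<n} - supp n \<theta>. d i) + (\<Sum>i\<in>supp n \<theta>. d i)"
    by (rule sum.subset_diff) (auto simp: supp_def)
  ultimately show ?thesis by (simp add: FDP_def sum_of_bool_times)
qed

lemma FNP_eq:
  assumes "supp n \<theta> \<noteq> {}"
  shows "FNP n \<theta> d = 1 - (\<Sum>i\<in>supp n \<theta>. d i) / card (supp n \<theta>)"
proof -
  have "finite (supp n \<theta>)" by (simp add: supp_def)
  then have "card (supp n \<theta>) > 0" using assms by (simp add: card_gt_0_iff)
  moreover have "{i. i < n \<and> \<theta> i \<noteq> 0} = supp n \<theta>" by (auto simp: supp_def)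
  moreover have "(\<Sum>i<n. of_bool (\<theta> i \<noteq> 0)) = (\<Sum>i<n. of_bool (\<theta> i \<noteq> 0) * 1 :: real)" by simp
  ultimately show ?thesis unfolding FNP_def
    by (simp only: sum_of_bool_times) (simp add: sum_subtractf field_simps)
qed

lemma FDP_FNP_bounds:
  assumes "\<And>i. i < n \<Longrightarrow> 0 \<le> d i \<and> d i \<le> 1"
  shows "0 \<le> FDP n \<theta> d" "FDP n \<theta> d \<le> 1" "0 \<le> FNP n \<theta> d" "FNP n \<theta> d \<le> 1"
proof -
  have ratio: "0 \<le> a / max 1 c \<and> a / max 1 c \<le> 1" if "0 \<le> a" "a \<le> c" for a c :: real
    using that by (auto simp: divide_simps)
  show "0 \<le> FDP n \<theta> d" "FDP n \<theta> d \<le> 1"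
    using assms unfolding FDP_def atomize_conj
    by (intro ratio sum_nonneg sum_mono) (auto simp: of_bool_def)
  show "0 \<le> FNP n \<theta> d" "FNP n \<theta> d \<le> 1"
    using assms unfolding FNP_def atomize_conj
    by (intro ratio sum_nonneg sum_mono) (auto simp: of_bool_def)
qed

lemma
  assumes \<phi>: "\<phi> \<in> procedures n"
  shows integrable_FDP: "integrable (obs_law n \<theta>) (\<lambda>x. FDP n \<theta> (\<phi> x))"
    and integrable_FNP: "integrable (obs_law n \<theta>) (\<lambda>x. FNP n \<theta> (\<phi> x))"
    and risk_eq_integral: "risk n \<theta> \<phi> = (\<integral>x. FDP n \<theta> (\<phi> x) + FNP n \<theta> (\<phi> x) \<partial>obs_law n \<theta>)"
proof -
  interpret prob_space "obs_law n \<theta>" by (rule prob_space_obs_law)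
  have [measurable]: "i < n \<Longrightarrow> (\<lambda>x. \<phi> x i) \<in> borel_measurable (Rn n)" for i
    by (rule borel_measurable_procedure[OF \<phi>])
  have meas: "(\<lambda>x. FDP n \<theta> (\<phi> x)) \<in> borel_measurable (Rn n)" "(\<lambda>x. FNP n \<theta> (\<phi> x)) \<in> borel_measurable (Rn n)"
    unfolding FDP_def FNP_def by measurable
  have "0 \<le> \<phi> x i \<and> \<phi> x i \<le> 1" if "x \<in> space (Rn n)" "i < n" for x i
    using procedure_values[OF \<phi> that] by auto
  note bd = FDP_FNP_bounds[of n "\<phi> x" \<theta> for x, OF this]
  show i1: "integrable (obs_law n \<theta>) (\<lambda>x. FDP n \<theta> (\<phi> x))"
    using meas bd by (intro integrable_const_bound[where B = 1]) auto
  show i2: "integrable (obs_law n \<theta>) (\<lambda>x. FNP n \<theta> (\<phi> x))"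
    using meas bd by (intro integrable_const_bound[where B = 1]) auto
  show "risk n \<theta> \<phi> = (\<integral>x. FDP n \<theta> (\<phi> x) + FNP n \<theta> (\<phi> x) \<partial>obs_law n \<theta>)"
    unfolding Bochner_Integration.integral_add[OF i1 i2] by (simp add: risk_def FDR_def FNR_def FDP_def FNP_def)
qed

text \<open>Linearizing the loss: a procedure making more than \<open>s / l\<close> discoveries has a false
  discovery proportion of at least \<open>1 - l\<close> and may as well make none; otherwise every false
  discovery costs at least \<open>l / s\<close>.\<close>

lemma FDP_FNP_ge_linear:
  assumes s: "card (supp n \<theta>) = s" "0 < s" and W: "W \<subseteq> {..<n} - supp n \<theta>"
    and l: "0 < l" "l \<le> 1" and d: "\<And>i. i < n \<Longrightarrow> 0 \<le> d i \<and> d i \<le> 1"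
    and e_def: "e = (\<lambda>i. if (\<Sum>j<n. d j) \<le> s / l then d i else 0)"
  shows "1 - l - ((\<Sum>i\<in>supp n \<theta>. e i) - l * (\<Sum>i\<in>W. e i)) / s \<le> FDP n \<theta> d + FNP n \<theta> d"
proof -
  define V where "V = (\<Sum>i\<in>{..<n} - supp n \<theta>. d i)"
  define P where "P = (\<Sum>i\<in>supp n \<theta>. d i)"
  have S: "supp n \<theta> \<subseteq> {..<n}" by (auto simp: supp_def)
  have R: "(\<Sum>j<n. d j) = V + P"
    unfolding V_def P_def using S by (intro sum.subset_diff) auto
  have V0: "0 \<le> V" unfolding V_def using d by (intro sum_nonneg) auto
  have P0: "0 \<le> P" unfolding P_def using d S by (intro sum_nonneg) auto
  have Ps: "P \<le> s"
    using sum_bounded_above[of "supp n \<theta>" d 1] d S s unfolding P_def by auto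
  have FDP: "FDP n \<theta> d = V / max 1 (V + P)" by (simp add: FDP_eq V_def P_def)
  have FNP: "FNP n \<theta> d = 1 - P / s" using s by (subst FNP_eq) (auto simp: P_def)
  \<comment> \<open>Lets \<open>s / l\<close> also dominate the 1 in the denominator of the false
    discovery proportion.\<close>
  have s1: "1 \<le> real s / l" using s(2) l by (simp add: le_divide_eq)
  show ?thesis
  proof (cases "V + P \<le> s / l")
    case True
    then have e: "e = d" by (auto simp: e_def R)
    have "(\<Sum>i\<in>W. d i) \<le> V" unfolding V_def using W d by (intro sum_mono2) auto
    then have "l * (\<Sum>i\<in>W. d i) / s \<le> V / (s / l)"
      using l s(2) by (simp add: divide_right_mono mult.commute)
    also have "\<dots> \<le> V / max 1 (V + P)"
      using True s1 V0 by (intro frac_le) auto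
    finally show ?thesis using l by (simp add: FDP FNP e P_def diff_divide_distrib)
  next
    case False
    then have e: "e = (\<lambda>_. 0)" by (auto simp: e_def R)
    \<comment> \<open>At most \<open>s\<close> discoveries are true, so these are less than a
      fraction \<open>l\<close> of all discoveries.\<close>
    have "s < l * (V + P)" using False l by (simp add: field_simps not_le)
    then have "(1 - l) * (V + P) \<le> V" using Ps by (simp add: algebra_simps)
    moreover have "1 < V + P" using False s1 by linarith
    ultimately have "1 - l \<le> FDP n \<theta> d" by (simp add: FDP le_divide_eq)
    moreover have "0 \<le> FNP n \<theta> d" using Ps s by (simp add: FNP)
    ultimately show ?thesis by (simp add: e)
  qed
qed

section \<open>Averages over offsets and the block configurations\<close>

text \<open>Exchanging \<open>c k\<close> with the fresh value \<open>r\<close> is an involution of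
  the pairs \<open>(c, r)\<close>. An average over all configurations can therefore be taken first
  over the offset of one block, with the other blocks fixed.\<close>

lemma sum_PiE_resample:
  fixes f :: "('k \<Rightarrow> 'a) \<Rightarrow> real"
  assumes "k \<in> K"
  shows "(\<Sum>c\<in>PiE K (\<lambda>_. A). \<Sum>r\<in>A. f (c(k := r))) = real (card A) * (\<Sum>c\<in>PiE K (\<lambda>_. A). f c)"
proof -
  let ?C = "PiE K (\<lambda>_. A)"
  let ?h = "\<lambda>(c, r). (c(k := r), c k)"
  have "(\<Sum>c\<in>?C. \<Sum>r\<in>A. f (c(k := r))) = (\<Sum>(c, r)\<in>?C \<times> A. f (c(k := r)))"
    by (rule sum.cartesian_product)
  also have "\<dots> = (\<Sum>(c, r)\<in>?C \<times> A. f c)"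
    using assms by (intro sum.reindex_bij_witness[where i = ?h and j = ?h])
      (auto simp: PiE_iff extensional_def split: if_splits)
  also have "\<dots> = (\<Sum>c\<in>?C. \<Sum>r\<in>A. f c)" by (rule sum.cartesian_product[symmetric])
  finally show ?thesis by (simp add: sum_distrib_left)
qed

text \<open>Interchanges the position of the signal and the position of a false discovery, so that
  all terms about the decision at one position are collected.\<close>

lemma sum_off_diagonal_swap:
  assumes "finite A"
  shows "(\<Sum>r\<in>A. \<Sum>t\<in>A-{r}. h r t) = (\<Sum>r\<in>A. \<Sum>t\<in>A-{r}. h t r)"
proof -
  have "(\<Sum>r\<in>A. \<Sum>t\<in>A-{r}. h r t) = (\<Sum>(r, t)\<in>Sigma A (\<lambda>r. A-{r}). h r t)"
    using assms by (intro sum.Sigma) auto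
  also have "\<dots> = (\<Sum>(r, t)\<in>Sigma A (\<lambda>r. A-{r}). h t r)"
    by (intro sum.reindex_bij_witness[where i = "\<lambda>(r, t). (t, r)" and j = "\<lambda>(r, t). (t, r)"]) auto
  also have "\<dots> = (\<Sum>r\<in>A. \<Sum>t\<in>A-{r}. h t r)"
    using assms by (intro sum.Sigma[symmetric]) auto
  finally show ?thesis .
qed

text \<open>The least favourable configurations: \<open>s\<close> consecutive blocks of length \<open>m\<close>, with one
  signal of size \<open>a\<close> at offset \<open>c k\<close> of block \<open>k\<close>. The out-of-range offset \<open>c k = m\<close> leaves
  block \<open>k\<close> without a signal.\<close>

definition block_signal :: "nat \<Rightarrow> nat \<Rightarrow> nat \<Rightarrow> real \<Rightarrow> (nat \<Rightarrow> nat) \<Rightarrow> nat \<Rightarrow> real" where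
  "block_signal n s m a c = (\<lambda>i\<in>{..<n}. if i < s * m \<and> i mod m = c (i div m) then a else 0)"

lemma block_index_less:
  fixes k s r m :: nat
  assumes "k < s" "r < m"
  shows "k * m + r < s * m"
proof -
  have "k * m + r < Suc k * m" using assms by simp
  also have "\<dots> \<le> s * m" using assms by (intro mult_le_mono1) simp
  finally show ?thesis .
qed

lemma supp_block_signal:
  assumes "s * m \<le> n" "a \<noteq> 0" "c \<in> {..<s} \<rightarrow>\<^sub>E {..<m}"
  shows "supp n (block_signal n s m a c) = (\<lambda>k. k * m + c k) ` {..<s}"
proof (intro equalityI subsetI)
  fix i assume "i \<in> supp n (block_signal n s m a c)"
  then have i: "i < s * m" "i mod m = c (i div m)"
    using assms(2) by (auto simp: supp_def block_signal_def split: if_splits)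
  then have "i div m < s" by (simp add: less_mult_imp_div_less)
  moreover have "i = i div m * m + c (i div m)" using i by (simp flip: i(2))
  ultimately show "i \<in> (\<lambda>k. k * m + c k) ` {..<s}" by blast
next
  fix i assume "i \<in> (\<lambda>k. k * m + c k) ` {..<s}"
  then obtain k where k: "k < s" "i = k * m + c k" by auto
  then have "c k < m" using assms(3) by auto
  then show "i \<in> supp n (block_signal n s m a c)"
    using k assms block_index_less[of k s "c k" m] by (auto simp: supp_def block_signal_def)
qed

lemma inj_block_index:
  assumes "c \<in> {..<s} \<rightarrow>\<^sub>E {..<m}"
  shows "inj_on (\<lambda>k::nat. k * m + c k) {..<s}"
proof (rule inj_onI)
  fix k k' assume k: "k \<in> {..<s}" "k' \<in> {..<s}" "k * m + c k = k' * m + c k'"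
  then have "c k < m" "c k' < m" using assms by auto
  then have "(k * m + c k) div m = k" "(k' * m + c k') div m = k'" by auto
  then show "k = k'" using k(3) by metis
qed

text \<open>The offset \<open>m\<close> is never a remainder modulo \<open>m\<close>, so
  \<open>c(k := m)\<close> empties block \<open>k\<close>. All positions of the signal in that block
  are then one-coordinate updates of the same vector, as the change of measure requires.\<close>

lemma block_signal_upd:
  assumes "s * m \<le> n" "k < s" "r < m" "c \<in> {..<s} \<rightarrow>\<^sub>E {..<m}"
  shows "block_signal n s m a (c(k := r)) = (block_signal n s m a (c(k := m)))(k * m + r := a)"
proof
  fix i
  have lt: "k * m + r < s * m" using assms by (intro block_index_less)
  have mod_ne: "i mod m \<noteq> m" using assms(3) by (metis mod_less_divisor less_irrefl less_zeroE neq0_conv)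
  show "block_signal n s m a (c(k := r)) i = ((block_signal n s m a (c(k := m)))(k * m + r := a)) i"
  proof (cases "i = k * m + r")
    case True
    then have "i div m = k" "i mod m = r" using assms(3) by auto
    moreover have "i < n" "i < s * m" using True lt assms(1) by auto
    ultimately show ?thesis using True by (simp only: block_signal_def) simp
  next
    case False
    have ne: "i mod m \<noteq> r" if "i div m = k" using False that by (metis div_mult_mod_eq)
    have "i mod m = (c(k := r)) (i div m) \<longleftrightarrow> i mod m = (c(k := m)) (i div m)"
      using ne mod_ne by (cases "i div m = k") auto
    then show ?thesis unfolding block_signal_def using False by simp
  qed
qed

section \<open>Lower bound\<close>

text \<open>The truncated decisions \<open>e\<close> of \<open>FDP_FNP_ge_linear\<close> as
  functions of the observation, taken with \<open>B = s / l\<close>. The cap couples all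
  coordinates, which \<open>block_discovery_bound\<close> allows: its \<open>g\<close> may depend on
  the whole observation.\<close>

definition cap_discoveries :: "nat \<Rightarrow> real \<Rightarrow> ((nat \<Rightarrow> real) \<Rightarrow> nat \<Rightarrow> real) \<Rightarrow> (nat \<Rightarrow> real) \<Rightarrow> nat \<Rightarrow> real" where
  "cap_discoveries n B \<phi> x i = (if (\<Sum>j<n. \<phi> x j) \<le> B then \<phi> x i else 0)"

lemma cap_discoveries_values:
  assumes "\<phi> \<in> procedures n" "x \<in> space (Rn n)" "i < n"
  shows "0 \<le> cap_discoveries n B \<phi> x i \<and> cap_discoveries n B \<phi> x i \<le> 1"
  using procedure_values[OF assms] by (auto simp: cap_discoveries_def)

lemma borel_measurable_cap_discoveries:
  assumes "\<phi> \<in> procedures n" "i < n"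
  shows "(\<lambda>x. cap_discoveries n B \<phi> x i) \<in> borel_measurable (Rn n)"
proof -
  have [measurable]: "j < n \<Longrightarrow> (\<lambda>x. \<phi> x j) \<in> borel_measurable (Rn n)" for j
    by (rule borel_measurable_procedure[OF assms(1)])
  show ?thesis using assms(2) unfolding cap_discoveries_def by measurable
qed

lemma integrable_cap_discoveries:
  assumes "\<phi> \<in> procedures n" "i < n"
  shows "integrable (obs_law n \<theta>) (\<lambda>x. cap_discoveries n B \<phi> x i)"
proof -
  interpret prob_space "obs_law n \<theta>" by (rule prob_space_obs_law)
  have "\<bar>cap_discoveries n B \<phi> x i\<bar> \<le> 1" if "x \<in> space (Rn n)" for x
    using cap_discoveries_values[OF assms(1) that assms(2), of B] by simp
  then show ?thesis
    using borel_measurable_cap_discoveries[OF assms]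
    by (intro integrable_const_bound[where B = 1]) auto
qed

text \<open>Integrating the linearized loss leaves a sum of expected decisions at single
  coordinates, which can be regrouped by blocks.\<close>

lemma risk_ge_linear:
  assumes \<phi>: "\<phi> \<in> procedures n"
    and s: "card (supp n \<theta>) = s" "0 < s" and W: "W \<subseteq> {..<n} - supp n \<theta>"
    and l: "0 < l" "l \<le> 1"
  defines "q \<equiv> \<lambda>i. \<integral>x. cap_discoveries n (s / l) \<phi> x i \<partial>obs_law n \<theta>"
  shows "1 - l - ((\<Sum>i\<in>supp n \<theta>. q i) - l * (\<Sum>i\<in>W. q i)) / s \<le> risk n \<theta> \<phi>"
proof -
  let ?e = "cap_discoveries n (s / l) \<phi>"
  interpret prob_space "obs_law n \<theta>" by (rule prob_space_obs_law)
  have S: "supp n \<theta> \<subseteq> {..<n}" by (auto simp: supp_def)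
  have int: "integrable (obs_law n \<theta>) (\<lambda>x. ?e x i)" if "i < n" for i
    using \<phi> that by (rule integrable_cap_discoveries)
  have int_sum: "integrable (obs_law n \<theta>) (\<lambda>x. \<Sum>i\<in>A. ?e x i)" if "A \<subseteq> {..<n}" for A
    using that by (intro Bochner_Integration.integrable_sum int) auto
  have sum: "(\<integral>x. (\<Sum>i\<in>A. ?e x i) \<partial>obs_law n \<theta>) = (\<Sum>i\<in>A. q i)" if "A \<subseteq> {..<n}" for A
    using that unfolding q_def by (intro Bochner_Integration.integral_sum int) auto
  have W': "W \<subseteq> {..<n}" using W by auto
  note ints = int_sum[OF S] int_sum[OF W']
  have "1 - l - ((\<Sum>i\<in>supp n \<theta>. q i) - l * (\<Sum>i\<in>W. q i)) / s
     = (\<integral>x. 1 - l - ((\<Sum>i\<in>supp n \<theta>. ?e x i) - l * (\<Sum>i\<in>W. ?e x i)) / s \<partial>obs_law n \<theta>)"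
    using ints prob_space by (simp add: sum[OF S] sum[OF W'])
  also have "\<dots> \<le> (\<integral>x. FDP n \<theta> (\<phi> x) + FNP n \<theta> (\<phi> x) \<partial>obs_law n \<theta>)"
  proof (rule integral_mono)
    show "integrable (obs_law n \<theta>) (\<lambda>x. 1 - l - ((\<Sum>i\<in>supp n \<theta>. ?e x i) - l * (\<Sum>i\<in>W. ?e x i)) / s)"
      using ints by simp
    show "integrable (obs_law n \<theta>) (\<lambda>x. FDP n \<theta> (\<phi> x) + FNP n \<theta> (\<phi> x))"
      using \<phi> by (intro Bochner_Integration.integrable_add integrable_FDP integrable_FNP)
    fix x assume "x \<in> space (obs_law n \<theta>)"
    then have "0 \<le> \<phi> x i \<and> \<phi> x i \<le> 1" if "i < n" for i
      using procedure_values[OF \<phi>, of x i] that by auto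
    then show "1 - l - ((\<Sum>i\<in>supp n \<theta>. ?e x i) - l * (\<Sum>i\<in>W. ?e x i)) / s \<le> FDP n \<theta> (\<phi> x) + FNP n \<theta> (\<phi> x)"
      by (rule FDP_FNP_ge_linear[OF s W l]) (simp_all add: cap_discoveries_def fun_eq_iff)
  qed
  finally show ?thesis by (simp add: risk_eq_integral[OF \<phi>])
qed

text \<open>A bound \<open>R\<close> on the risk at every configuration bounds the average over all
  offsets. The linear bound splits this average into blocks, and resampling the offset of one block
  reduces it to \<open>block_discovery_bound\<close>.\<close>

lemma risk_block_signals_ge:
  assumes \<phi>: "\<phi> \<in> procedures n" and s: "0 < s" and m: "0 < m" and sm: "s * m \<le> n"
    and a: "0 < a" and l: "0 < l" "l \<le> 1"
    and R: "\<And>c. c \<in> {..<s} \<rightarrow>\<^sub>E {..<m} \<Longrightarrow> risk n (block_signal n s m a c) \<phi> \<le> R"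
  shows "1 - l - ((1 - Phi_bar T) ^ (m - 1) + Phi_bar (T + ln l / a - a)) \<le> R"
proof -
  define C where "C = ({..<s} \<rightarrow>\<^sub>E {..<m})"
  define B where "B = (1 - Phi_bar T) ^ (m - 1) + Phi_bar (T + ln l / a - a)"
  let ?\<theta> = "block_signal n s m a"
  define q where "q = (\<lambda>\<theta> i. \<integral>x. cap_discoveries n (s / l) \<phi> x i \<partial>obs_law n \<theta>)"
  \<comment> \<open>The net gain of block \<open>k\<close>: the expected true discovery minus
    \<open>l\<close> times the expected false discoveries in the same block.\<close>
  define G where "G = (\<lambda>k c. q (?\<theta> c) (k * m + c k) - l * (\<Sum>r\<in>{..<m}-{c k}. q (?\<theta> c) (k * m + r)))"
  have finC: "finite C" unfolding C_def by (intro finite_PiE) auto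
  have cardC: "card C > 0"
    using m unfolding C_def by (simp add: card_PiE)
  have pos_lt: "k * m + r < n" if "k < s" "r < m" for k r
    using block_index_less[OF that] sm by simp
  have average: "1 - l - (\<Sum>k<s. G k c) / s \<le> R" if c: "c \<in> C" for c
  proof -
    \<comment> \<open>\<open>N\<close> lists the signal-free offsets of each block and
      \<open>W\<close> the coordinates they denote. Coordinates from \<open>s * m\<close> on are
      left uncharged, which can only lower the bound.\<close>
    define N where "N = (SIGMA k:{..<s}. {..<m} - {c k})"
    define W where "W = (\<lambda>(k, r). k * m + r) ` N"
    have c': "c \<in> {..<s} \<rightarrow>\<^sub>E {..<m}" using c by (simp add: C_def)
    have S: "supp n (?\<theta> c) = (\<lambda>k. k * m + c k) ` {..<s}"
      using sm a c' by (intro supp_block_signal) auto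
    have inj: "inj_on (\<lambda>k. k * m + c k) {..<s}" by (rule inj_block_index[OF c'])
    have dm: "(k * m + r) div m = k" "(k * m + r) mod m = r" if "r < m" for k r using that by auto
    have injN: "inj_on (\<lambda>(k, r). k * m + r) N"
    proof (rule inj_onI, clarify)
      fix k r k' r' assume "(k, r) \<in> N" "(k', r') \<in> N" and e: "k * m + r = k' * m + r'"
      then have "r < m" "r' < m" by (auto simp: N_def)
      then show "k = k' \<and> r = r'" using dm e by metis
    qed
    have W: "W \<subseteq> {..<n} - supp n (?\<theta> c)"
    proof
      fix i assume "i \<in> W"
      then obtain k r where k: "k < s" "r < m" "r \<noteq> c k" "i = k * m + r" by (auto simp: W_def N_def)
      have "i \<noteq> k' * m + c k'" if "k' < s" for k'
      proof
        assume "i = k' * m + c k'"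
        moreover have "c k' < m" using c' that by auto
        ultimately show False using k dm by metis
      qed
      then show "i \<in> {..<n} - supp n (?\<theta> c)" using k pos_lt by (auto simp: S)
    qed
    have "card (supp n (?\<theta> c)) = s" unfolding S using inj by (simp add: card_image)
    from risk_ge_linear[OF \<phi> this s W l]
    have "1 - l - ((\<Sum>i\<in>supp n (?\<theta> c). q (?\<theta> c) i) - l * (\<Sum>i\<in>W. q (?\<theta> c) i)) / s \<le> risk n (?\<theta> c) \<phi>"
      by (simp add: q_def)
    also have "\<dots> \<le> R" by (rule R[OF c'])
    also have "(\<Sum>i\<in>supp n (?\<theta> c). q (?\<theta> c) i) = (\<Sum>k<s. q (?\<theta> c) (k * m + c k))"
      unfolding S by (subst sum.reindex[OF inj]) simp
    also have "(\<Sum>i\<in>W. q (?\<theta> c) i) = (\<Sum>k<s. \<Sum>r\<in>{..<m}-{c k}. q (?\<theta> c) (k * m + r))"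
      unfolding W_def by (subst sum.reindex[OF injN]) (simp add: N_def sum.Sigma split_def)
    finally show ?thesis by (simp add: G_def sum_subtractf sum_distrib_left)
  qed
  \<comment> \<open>The other blocks stay fixed while the signal of block \<open>k\<close> runs
    through its \<open>m\<close> offsets.\<close>
  have block: "(\<Sum>r<m. G k (c(k := r))) \<le> m * B" if k: "k < s" and c: "c \<in> C" for k c
  proof -
    define \<theta>0 where "\<theta>0 = ?\<theta> (c(k := m))"
    have upd: "?\<theta> (c(k := r)) = \<theta>0(k * m + r := a)" if "r < m" for r
      unfolding \<theta>0_def using sm k that c by (intro block_signal_upd) (auto simp: C_def)
    let ?p = "\<lambda>r. k * m + r"
    let ?h = "\<lambda>r t. q (\<theta>0(?p r := a)) (?p t)"
    have inj: "inj_on ?p A" for A by (auto simp: inj_on_def)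
    have "(\<Sum>r<m. G k (c(k := r))) = (\<Sum>r<m. ?h r r - l * (\<Sum>t\<in>{..<m}-{r}. ?h r t))"
      by (intro sum.cong) (simp_all add: G_def upd)
    also have "\<dots> = (\<Sum>r<m. ?h r r) - l * (\<Sum>r<m. \<Sum>t\<in>{..<m}-{r}. ?h r t)"
      by (simp add: sum_subtractf sum_distrib_left)
    \<comment> \<open>After the swap, the summand for \<open>r\<close> concerns only the decision at
      offset \<open>r\<close>, under varying positions of the signal.\<close>
    also have "(\<Sum>r<m. \<Sum>t\<in>{..<m}-{r}. ?h r t) = (\<Sum>r<m. \<Sum>t\<in>{..<m}-{r}. ?h t r)"
      by (rule sum_off_diagonal_swap) simp
    also have "(\<Sum>r<m. ?h r r) - l * \<dots> = (\<Sum>r<m. ?h r r - l * (\<Sum>t\<in>{..<m}-{r}. ?h t r))"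
      by (simp add: sum_subtractf sum_distrib_left)
    also have "\<dots> \<le> of_nat (card {..<m}) * B"
    proof (rule sum_bounded_above)
      fix r assume "r \<in> {..<m}"
      then have r: "r < m" by simp
      let ?I = "?p ` {..<m}"
      have zero: "\<theta>0 j = 0" if "j \<in> ?I" for j
        using that pos_lt[OF k] m by (auto simp: \<theta>0_def block_signal_def)
      have "(\<integral>x. cap_discoveries n (s / l) \<phi> x (?p r) \<partial>obs_law n (\<theta>0(?p r := a)))
          - l * (\<Sum>j\<in>?I - {?p r}. \<integral>x. cap_discoveries n (s / l) \<phi> x (?p r) \<partial>obs_law n (\<theta>0(j := a)))
        \<le> (1 - Phi_bar T) ^ (card ?I - 1) + Phi_bar (T + ln l / a - a)"
        using r pos_lt[OF k] zero a l \<phi>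
        by (intro block_discovery_bound borel_measurable_cap_discoveries cap_discoveries_values) auto
      also have "?I - {?p r} = ?p ` ({..<m} - {r})" by auto
      also have "card ?I = m" using inj by (simp add: card_image)
      finally show "?h r r - l * (\<Sum>t\<in>{..<m}-{r}. ?h t r) \<le> B"
        unfolding B_def q_def by (subst (asm) sum.reindex[OF inj]) (simp add: o_def)
    qed
    finally show ?thesis by (simp only: card_lessThan)
  qed
  \<comment> \<open>Resampling counts every configuration \<open>m\<close> times, which cancels the
    factor \<open>m\<close> of the block bound.\<close>
  have total: "(\<Sum>c\<in>C. G k c) \<le> card C * B" if k: "k < s" for k
  proof -
    have "m * (\<Sum>c\<in>C. G k c) = (\<Sum>c\<in>C. \<Sum>r<m. G k (c(k := r)))"
      unfolding C_def using k by (subst sum_PiE_resample) auto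
    also have "\<dots> \<le> of_nat (card C) * (m * B)"
      using k by (intro sum_bounded_above block)
    finally have "m * (\<Sum>c\<in>C. G k c) \<le> m * (card C * B)" by (simp add: mult_ac)
    then show ?thesis using m by simp
  qed
  have "card C * (1 - l - B) \<le> card C * (1 - l) - (\<Sum>k<s. \<Sum>c\<in>C. G k c) / s"
  proof -
    have "(\<Sum>k<s. \<Sum>c\<in>C. G k c) \<le> of_nat (card {..<s}) * (card C * B)"
      by (intro sum_bounded_above total) auto
    then have "(\<Sum>k<s. \<Sum>c\<in>C. G k c) / s \<le> card C * B"
      using s by (simp add: divide_le_eq mult_ac)
    then show ?thesis by (simp add: algebra_simps)
  qed
  also have "\<dots> = (\<Sum>c\<in>C. 1 - l - (\<Sum>k<s. G k c) / s)"
    by (subst sum.swap) (simp add: sum_subtractf sum_divide_distrib)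
  also have "\<dots> \<le> of_nat (card C) * R"
    by (intro sum_bounded_above average)
  finally have "card C * (1 - l - B) \<le> card C * R" .
  then show ?thesis using cardC by (simp add: B_def)
qed

lemma block_signal_in_Theta:
  assumes "s * m \<le> n" "0 < a" "signal_bound n s b \<le> a" "c \<in> {..<s} \<rightarrow>\<^sub>E {..<m}"
  shows "block_signal n s m a c \<in> Theta n s b"
proof -
  have S: "supp n (block_signal n s m a c) = (\<lambda>k. k * m + c k) ` {..<s}"
    using assms by (intro supp_block_signal) auto
  have "card (supp n (block_signal n s m a c)) = s"
    unfolding S using inj_block_index[OF assms(4)] by (simp add: card_image)
  moreover have "signal_bound n s b \<le> \<bar>block_signal n s m a c i\<bar>" if "i \<in> supp n (block_signal n s m a c)" for i
    using that assms by (auto simp: supp_def block_signal_def split: if_splits)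
  moreover have "block_signal n s m a c \<in> space (Rn n)"
    by (auto simp: space_PiM block_signal_def)
  ultimately show ?thesis by (simp add: Theta_def)
qed

section \<open>Order properties of the minimax risk\<close>

lemma risk_le_Sup:
  assumes "\<phi> \<in> procedures n" "\<theta> \<in> Theta n s b"
  shows "risk n \<theta> \<phi> \<le> (SUP \<theta>\<in>Theta n s b. risk n \<theta> \<phi>)"
  using assms risk_bounds(2)[OF assms(1)] by (intro cSUP_upper bdd_aboveI[where M = 2]) auto

lemma minimax_risk_greatest:
  assumes "\<And>\<phi>. \<phi> \<in> procedures n \<Longrightarrow> r \<le> (SUP \<theta>\<in>Theta n s b. risk n \<theta> \<phi>)"
  shows "r \<le> minimax_risk n s b"
  unfolding minimax_risk_def using assms procedures_nonempty by (intro cINF_greatest) auto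

lemma minimax_risk_le_Sup:
  assumes "\<phi> \<in> procedures n" "s \<le> n"
  shows "minimax_risk n s b \<le> (SUP \<theta>\<in>Theta n s b. risk n \<theta> \<phi>)"
  unfolding minimax_risk_def
proof (intro cINF_lower assms(1) bdd_belowI[where m = 0])
  fix r assume "r \<in> (\<lambda>\<phi>. SUP \<theta>\<in>Theta n s b. risk n \<theta> \<phi>) ` procedures n"
  then obtain \<phi> where \<phi>: "\<phi> \<in> procedures n" "r = (SUP \<theta>\<in>Theta n s b. risk n \<theta> \<phi>)" by auto
  obtain \<theta> where "\<theta> \<in> Theta n s b" using Theta_nonempty[OF assms(2)] by blast
  from risk_le_Sup[OF \<phi>(1) this] show "0 \<le> r" using risk_bounds(1)[OF \<phi>(1), of \<theta>] \<phi>(2) by linarith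
qed

lemma minimax_risk_le:
  assumes "\<phi> \<in> procedures n" "s \<le> n" "\<And>\<theta>. \<theta> \<in> Theta n s b \<Longrightarrow> risk n \<theta> \<phi> \<le> r"
  shows "minimax_risk n s b \<le> r"
proof -
  have "(SUP \<theta>\<in>Theta n s b. risk n \<theta> \<phi>) \<le> r"
    using assms Theta_nonempty by (intro cSUP_least) auto
  then show ?thesis using minimax_risk_le_Sup[OF assms(1,2), of b] by linarith
qed

text \<open>A larger \<open>b\<close> shrinks the parameter set. This carries the result for fixed
  \<open>b\<close> over to diverging sequences.\<close>

lemma minimax_risk_antimono:
  assumes "s \<le> n" "b \<le> b'"
  shows "minimax_risk n s b' \<le> minimax_risk n s b"
proof (rule minimax_risk_greatest)
  fix \<phi> assume \<phi>: "\<phi> \<in> procedures n"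
  show "minimax_risk n s b' \<le> (SUP \<theta>\<in>Theta n s b. risk n \<theta> \<phi>)"
  proof (rule minimax_risk_le[OF \<phi> assms(1)])
    fix \<theta> assume \<theta>: "\<theta> \<in> Theta n s b'"
    have "signal_bound n s b \<le> signal_bound n s b'"
      using assms(2) by (simp add: signal_bound_def)
    then have "\<theta> \<in> Theta n s b"
      using \<theta> unfolding Theta_def by (blast intro: order_trans)
    then show "risk n \<theta> \<phi> \<le> (SUP \<theta>\<in>Theta n s b. risk n \<theta> \<phi>)"
      by (rule risk_le_Sup[OF \<phi>])
  qed
qed

lemma minimax_risk_nonneg:
  assumes "s \<le> n"
  shows "0 \<le> minimax_risk n s b"
proof (rule minimax_risk_greatest)
  fix \<phi> assume \<phi>: "\<phi> \<in> procedures n"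
  obtain \<theta> where "\<theta> \<in> Theta n s b" using Theta_nonempty[OF assms] by blast
  from risk_le_Sup[OF \<phi> this] show "0 \<le> (SUP \<theta>\<in>Theta n s b. risk n \<theta> \<phi>)"
    using risk_bounds(1)[OF \<phi>, of \<theta>] by linarith
qed

text \<open>Never rejecting makes no false discovery and has a false negative proportion of at most
  1. This is the upper half of the case where \<open>b\<close> tends to minus infinity.\<close>

lemma minimax_risk_le_1:
  assumes "0 < s" "s \<le> n"
  shows "minimax_risk n s b \<le> 1"
proof (rule minimax_risk_le)
  show proc: "(\<lambda>x. \<lambda>i\<in>{..<n}. 0) \<in> procedures n"
    unfolding procedures_def by (intro measurable_restrict) auto
  fix \<theta> assume "\<theta> \<in> Theta n s b"
  interpret prob_space "obs_law n \<theta>" by (rule prob_space_obs_law)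
  have "risk n \<theta> (\<lambda>x. \<lambda>i\<in>{..<n}. 0) = FNP n \<theta> (\<lambda>i\<in>{..<n}. 0)"
    using prob_space by (simp add: risk_eq_integral[OF proc] FDP_def)
  also have "\<dots> \<le> 1" by (rule FDP_FNP_bounds) simp
  finally show "risk n \<theta> (\<lambda>x. \<lambda>i\<in>{..<n}. 0) \<le> 1" .
qed (use assms in auto)

text \<open>Every signal gets the smallest admissible size, and the blocks have length
  \<open>n div s\<close>, so that \<open>s\<close> of them fit into \<open>n\<close>. The level
  \<open>T\<close> and the cost \<open>l\<close> are still free.\<close>

lemma minimax_risk_ge:
  assumes s: "0 < s" "s \<le> n" and a: "0 < signal_bound n s b" and l: "0 < l" "l \<le> 1"
  shows "1 - l - (1 - Phi_bar T) ^ (n div s - 1) - Phi_bar (T + ln l / signal_bound n s b - signal_bound n s b)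
    \<le> minimax_risk n s b"
proof (rule minimax_risk_greatest)
  fix \<phi> assume \<phi>: "\<phi> \<in> procedures n"
  have m: "0 < n div s" "s * (n div s) \<le> n" using s by (auto simp: div_greater_zero_iff)
  have "1 - l - ((1 - Phi_bar T) ^ (n div s - 1) + Phi_bar (T + ln l / signal_bound n s b - signal_bound n s b))
    \<le> (SUP \<theta>\<in>Theta n s b. risk n \<theta> \<phi>)"
    using m a by (intro risk_block_signals_ge[OF \<phi> s(1) m a l] risk_le_Sup[OF \<phi>] block_signal_in_Theta) auto
  then show "1 - l - (1 - Phi_bar T) ^ (n div s - 1) - Phi_bar (T + ln l / signal_bound n s b - signal_bound n s b)
    \<le> (SUP \<theta>\<in>Theta n s b. risk n \<theta> \<phi>)" by linarith
qed

section \<open>Upper bound\<close>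

definition threshold_procedure :: "nat \<Rightarrow> real \<Rightarrow> (nat \<Rightarrow> real) \<Rightarrow> nat \<Rightarrow> real" where
  "threshold_procedure n t x = (\<lambda>i\<in>{..<n}. of_bool (t < \<bar>x i\<bar>))"

lemma threshold_procedure_in_procedures: "threshold_procedure n t \<in> procedures n"
proof -
  have "(\<lambda>x. of_bool (t < \<bar>x i\<bar>) :: real) \<in> measurable (Rn n) (count_space {0, 1})" if "i \<in> {..<n}" for i
  proof -
    have [measurable]: "(\<lambda>x. x i) \<in> measurable (Rn n) borel"
      using that by (intro measurable_component_singleton) auto
    have "(\<lambda>x. if t < \<bar>x i\<bar> then 1 else 0 :: real) \<in> measurable (Rn n) (count_space {0, 1})"
      by measurable
    then show ?thesis by (simp add: of_bool_def)
  qed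
  then show ?thesis
    unfolding procedures_def threshold_procedure_def by (intro measurable_restrict)
qed

lemma measure_gauss_two_sided_null:
  "measure (gauss 0) {y. t < \<bar>y\<bar>} \<le> 2 * Phi_bar t"
proof -
  interpret prob_space "gauss 0" by (rule prob_space_gauss)
  have "measure (gauss 0) {y. t < \<bar>y\<bar>} \<le> measure (gauss 0) ({t<..} \<union> {..<-t})"
    by (intro finite_measure_mono) auto
  also have "\<dots> \<le> measure (gauss 0) {t<..} + measure (gauss 0) {..<-t}"
    by (intro measure_Un_le) auto
  also have "\<dots> = 2 * Phi_bar t"
    by (simp add: measure_gauss_greaterThan measure_gauss_lessThan Phi_bar_minus)
  finally show ?thesis .
qed

text \<open>Only the tail on the side of the sign of \<open>\<mu>\<close> is kept.\<close>

lemma measure_gauss_two_sided_signal: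
  assumes "A \<le> \<bar>\<mu>\<bar>"
  shows "Phi_bar (t - A) \<le> measure (gauss \<mu>) {y. t < \<bar>y\<bar>}"
proof -
  interpret prob_space "gauss \<mu>" by (rule prob_space_gauss)
  have sets: "{y. t < \<bar>y\<bar>} \<in> sets (borel :: real measure)" by measurable
  show ?thesis
  proof (cases "0 \<le> \<mu>")
    case True
    have "Phi_bar (t - A) \<le> measure (gauss \<mu>) {t<..}"
      using True assms by (simp add: measure_gauss_greaterThan Phi_bar_antimono)
    also have "\<dots> \<le> measure (gauss \<mu>) {y. t < \<bar>y\<bar>}"
      using sets by (intro finite_measure_mono) auto
    finally show ?thesis .
  next
    case False
    have "Phi_bar (t - A) \<le> Phi_bar (t + \<mu>)"
      using False assms by (intro Phi_bar_antimono) auto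
    also have "\<dots> = measure (gauss \<mu>) {..<-t}"
      using Phi_bar_minus[of "t + \<mu>"] by (simp add: measure_gauss_lessThan)
    also have "\<dots> \<le> measure (gauss \<mu>) {y. t < \<bar>y\<bar>}"
      using sets by (intro finite_measure_mono) auto
    finally show ?thesis .
  qed
qed

lemma indep_coordinates_obs_law:
  "prob_space.indep_vars (obs_law n \<theta>) (\<lambda>_. borel) (\<lambda>i x. x i) {..<n}"
proof -
  interpret prob_space "obs_law n \<theta>" by (rule prob_space_obs_law)
  show ?thesis
  proof (cases "n = 0")
    case True
    \<comment> \<open>The characterization of independence by the joint law, used for positive
      \<open>n\<close>, asks for a nonempty index set.\<close>
    then show ?thesis unfolding indep_vars_def indep_sets_def by simp
  next
    case False
    have rv: "random_variable borel (\<lambda>x. x i)" if "i \<in> {..<n}" for i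
      using that by (simp add: measurable_component_singleton)
    have marg: "distr (obs_law n \<theta>) borel (\<lambda>x. x i) = gauss (\<theta> i)" if "i \<in> {..<n}" for i
    proof -
      have "distr (PiM {..<n} (\<lambda>i. gauss (\<theta> i))) (gauss (\<theta> i)) (\<lambda>x. x i) = gauss (\<theta> i)"
        using that by (intro distr_PiM_component prob_space_gauss)
      moreover have "distr (obs_law n \<theta>) borel (\<lambda>x. x i)
          = distr (PiM {..<n} (\<lambda>i. gauss (\<theta> i))) (gauss (\<theta> i)) (\<lambda>x. x i)"
        unfolding obs_law_eq_PiM by (intro distr_cong) auto
      ultimately show ?thesis by simp
    qed
    have "distr (obs_law n \<theta>) (Rn n) (\<lambda>x. \<lambda>i\<in>{..<n}. x i) = distr (obs_law n \<theta>) (obs_law n \<theta>) (\<lambda>x. x)"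
      by (intro distr_cong) (auto simp: space_PiM PiE_restrict)
    also have "\<dots> = obs_law n \<theta>" by (rule distr_id)
    also have "\<dots> = PiM {..<n} (\<lambda>i. distr (obs_law n \<theta>) borel (\<lambda>x. x i))"
      unfolding obs_law_eq_PiM[of n \<theta>] by (intro PiM_cong refl) (simp add: marg flip: obs_law_eq_PiM)
    finally show ?thesis
      using False rv by (subst indep_vars_iff_distr_eq_PiM') auto
  qed
qed

text \<open>The term \<open>1 - p\<close> bounds the missed signals. The exponential bounds the
  probability of at most \<open>s * p / 2\<close> true discoveries. Otherwise the denominator of the
  false discovery proportion exceeds \<open>s * p / 2\<close>, and the last term divides the
  expected number of false discoveries by it.\<close>

lemma threshold_risk_le:
  assumes \<theta>: "\<theta> \<in> Theta n s b" and s: "0 < s" and t: "0 \<le> t"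
  defines "p \<equiv> Phi_bar (t - signal_bound n s b)"
  shows "risk n \<theta> (threshold_procedure n t)
    \<le> 1 - p + exp (- (s * p\<^sup>2) / 2) + 4 * n * exp (- t\<^sup>2 / 2) / (s * p)"
proof -
  let ?M = "obs_law n \<theta>" and ?d = "threshold_procedure n t"
  let ?S = "supp n \<theta>"
  interpret prob_space ?M by (rule prob_space_obs_law)
  note proc = threshold_procedure_in_procedures[of n t]
  have S: "?S \<subseteq> {..<n}" "finite ?S" by (auto simp: supp_def)
  have card: "card ?S = s" using \<theta> by (simp add: Theta_def)
  have p0: "0 < p" by (simp add: p_def Phi_bar_pos)
  have sp: "0 < s * p" using s p0 by simp
  have d01: "0 \<le> ?d x i \<and> ?d x i \<le> 1" if "i < n" for x i
    using that by (simp add: threshold_procedure_def)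
  have sets: "{y. t < \<bar>y\<bar>} \<in> sets (borel :: real measure)" by measurable
  have meas: "(\<lambda>x. ?d x i) \<in> borel_measurable (Rn n)" if "i < n" for i
    by (rule borel_measurable_procedure[OF proc that])
  have int: "integrable ?M (\<lambda>x. ?d x i)" if "i < n" for i
    using d01 meas that by (intro integrable_const_bound[where B = 1]) auto
  have E: "(\<integral>x. ?d x i \<partial>?M) = measure (gauss (\<theta> i)) {y. t < \<bar>y\<bar>}" if i: "i < n" for i
  proof -
    have "(\<lambda>x. x i) \<in> measurable (Rn n) borel"
      using i by (intro measurable_component_singleton) auto
    from measurable_sets[OF this sets] have "{x \<in> space (Rn n). x i \<in> {y. t < \<bar>y\<bar>}} \<in> sets (Rn n)"
      by (simp add: vimage_def Int_def conj_commute)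
    moreover have "(\<integral>x. ?d x i \<partial>?M) = (\<integral>x. indicator {x \<in> space (Rn n). x i \<in> {y. t < \<bar>y\<bar>}} x \<partial>?M)"
      using i by (intro Bochner_Integration.integral_cong) (auto simp: threshold_procedure_def)
    ultimately have "(\<integral>x. ?d x i \<partial>?M) = measure ?M {x \<in> space (Rn n). x i \<in> {y. t < \<bar>y\<bar>}}"
      by (simp add: Int_absorb2 sets.sets_into_space)
    then show ?thesis using measure_obs_law_coordinate[OF i sets] by simp
  qed
  have E_signal: "p \<le> (\<integral>x. ?d x i \<partial>?M)" if "i \<in> ?S" for i
  proof -
    have "signal_bound n s b \<le> \<bar>\<theta> i\<bar>" using \<theta> that by (auto simp: Theta_def)
    then show ?thesis using that E measure_gauss_two_sided_signal by (auto simp: p_def supp_def)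
  qed
  have E_null: "(\<integral>x. ?d x i \<partial>?M) \<le> 2 * exp (- t\<^sup>2 / 2)" if "i \<in> {..<n} - ?S" for i
  proof -
    have "\<theta> i = 0" "i < n" using that by (auto simp: supp_def)
    then have "(\<integral>x. ?d x i \<partial>?M) \<le> 2 * Phi_bar t"
      using E measure_gauss_two_sided_null[of t] by simp
    then show ?thesis using Phi_bar_le_exp[OF t] by simp
  qed

  have FNR: "(\<integral>x. FNP n \<theta> (?d x) \<partial>?M) \<le> 1 - p"
  proof -
    have "?S \<noteq> {}" using card s by auto
    then have "(\<integral>x. FNP n \<theta> (?d x) \<partial>?M) = (\<integral>x. 1 - (\<Sum>i\<in>?S. ?d x i) / s \<partial>?M)"
      by (simp add: FNP_eq card)
    also have "\<dots> = 1 - (\<Sum>i\<in>?S. \<integral>x. ?d x i \<partial>?M) / s"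
      using S int prob_space by (subst Bochner_Integration.integral_diff) (auto intro!: Bochner_Integration.integrable_sum simp: Bochner_Integration.integral_sum subset_eq)
    also have "\<dots> \<le> 1 - (\<Sum>i\<in>?S. p) / s"
      using s by (intro diff_left_mono divide_right_mono sum_mono E_signal) auto
    finally show ?thesis using s by (simp add: card)
  qed

  have [measurable]: "(\<lambda>x. \<Sum>i\<in>?S. ?d x i) \<in> borel_measurable (Rn n)"
    using S meas by (intro borel_measurable_sum) auto
  define L where "L = {x \<in> space ?M. (\<Sum>i\<in>?S. ?d x i) \<le> s * p / 2}"
  have L_sets: "L \<in> sets ?M"
    unfolding L_def by measurable
  have few: "measure ?M L \<le> exp (- (s * p\<^sup>2) / 2)"
  proof -
    interpret H: Hoeffding_ineq ?M ?S "\<lambda>i x. ?d x i" "\<lambda>_. 0" "\<lambda>_. 1" "\<Sum>i\<in>?S. \<integral>x. ?d x i \<partial>?M"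
    proof unfold_locales
      have "indep_vars (\<lambda>_. borel) (\<lambda>i x. x i) ?S"
        using indep_coordinates_obs_law S(1) by (rule indep_vars_subset)
      then have "indep_vars (\<lambda>_. borel) (\<lambda>i x. of_bool (t < \<bar>x i\<bar>) :: real) ?S"
        by (rule indep_vars_compose2) auto
      then show "indep_vars (\<lambda>_. borel) (\<lambda>i x. ?d x i) ?S"
        by (rule indep_vars_cong[THEN iffD1, rotated -1]) (use S in \<open>auto simp: threshold_procedure_def\<close>)
    qed (use S d01 in auto)
    let ?\<mu> = "\<Sum>i\<in>?S. \<integral>x. ?d x i \<partial>?M"
    have "s * p = (\<Sum>i\<in>?S. p)" by (simp add: card)
    also have "\<dots> \<le> ?\<mu>" by (intro sum_mono E_signal)
    finally have \<mu>: "s * p \<le> ?\<mu>" .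
    \<comment> \<open>The mean number of true discoveries is at least \<open>s * p\<close>, so
      \<open>L\<close> forces a deviation of at least \<open>s * p / 2\<close>. The summands lie in
      [0, 1], hence the squared ranges in Hoeffding's inequality add up to \<open>s\<close>.\<close>
    have "L \<subseteq> {x \<in> space ?M. (\<Sum>i\<in>?S. ?d x i) \<le> ?\<mu> - s * p / 2}"
      using \<mu> by (auto simp: L_def)
    then have "measure ?M L \<le> measure ?M {x \<in> space ?M. (\<Sum>i\<in>?S. ?d x i) \<le> ?\<mu> - s * p / 2}"
      by (intro finite_measure_mono) measurable
    also have "\<dots> \<le> exp (- 2 * (s * p / 2)\<^sup>2 / (\<Sum>i\<in>?S. (1 - 0)\<^sup>2))"
      using sp s by (intro H.Hoeffding_ineq_le) (auto simp: card)
    also have "- 2 * (s * p / 2)\<^sup>2 / (\<Sum>i\<in>?S. (1 - 0)\<^sup>2) = - (s * p\<^sup>2) / 2"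
      using s by (simp add: card power2_eq_square field_simps)
    finally show ?thesis .
  qed

  have FDR: "(\<integral>x. FDP n \<theta> (?d x) \<partial>?M) \<le> exp (- (s * p\<^sup>2) / 2) + 4 * n * exp (- t\<^sup>2 / 2) / (s * p)"
  proof -
    have sub: "{..<n} - ?S \<subseteq> {..<n}" by auto
    have "(\<integral>x. FDP n \<theta> (?d x) \<partial>?M) \<le> (\<integral>x. indicator L x + (\<Sum>i\<in>{..<n}-?S. ?d x i) * (2 / (s * p)) \<partial>?M)"
    proof (rule integral_mono)
      show "integrable ?M (\<lambda>x. indicator L x + (\<Sum>i\<in>{..<n}-?S. ?d x i) * (2 / (s * p)))"
        using L_sets int by (auto intro!: Bochner_Integration.integrable_add Bochner_Integration.integrable_sum integrable_mult_left simp: less_top[symmetric])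
      fix x assume x: "x \<in> space ?M"
      define V where "V = (\<Sum>i\<in>{..<n} - ?S. ?d x i)"
      define P where "P = (\<Sum>i\<in>?S. ?d x i)"
      have V0: "0 \<le> V" unfolding V_def using d01 by (intro sum_nonneg) auto
      show "FDP n \<theta> (?d x) \<le> indicator L x + (\<Sum>i\<in>{..<n}-?S. ?d x i) * (2 / (s * p))"
      proof (cases "x \<in> L")
        case True
        have "FDP n \<theta> (?d x) \<le> 1" using d01 by (rule FDP_FNP_bounds)
        moreover have "0 \<le> V * (2 / (s * p))" using V0 sp by simp
        ultimately show ?thesis using True by (simp add: V_def)
      next
        case False
        then have "s * p / 2 < P" using x by (auto simp: L_def P_def)
        then have "s * p / 2 \<le> max 1 (V + P)" using V0 by linarith
        then have "V / max 1 (V + P) \<le> V / (s * p / 2)"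
          using V0 sp by (intro frac_le) auto
        then show ?thesis using False by (simp add: FDP_eq flip: V_def P_def)
      qed
    qed (rule integrable_FDP[OF proc])
    also have "\<dots> = measure ?M L + (\<Sum>i\<in>{..<n}-?S. \<integral>x. ?d x i \<partial>?M) * (2 / (s * p))"
      using L_sets int sets.sets_into_space[OF L_sets]
      by (subst Bochner_Integration.integral_add)
         (auto intro!: Bochner_Integration.integrable_sum integrable_mult_left
           simp: Bochner_Integration.integral_sum Int_absorb2 less_top[symmetric])
    also have "\<dots> \<le> exp (- (s * p\<^sup>2) / 2) + (n * (2 * exp (- t\<^sup>2 / 2))) * (2 / (s * p))"
    proof (intro add_mono few mult_right_mono)
      have "(\<Sum>i\<in>{..<n}-?S. \<integral>x. ?d x i \<partial>?M) \<le> of_nat (card ({..<n}-?S)) * (2 * exp (- t\<^sup>2 / 2))"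
        by (intro sum_bounded_above E_null)
      also have "\<dots> \<le> n * (2 * exp (- t\<^sup>2 / 2))"
        using card_mono[of "{..<n}" "{..<n} - ?S"] by (intro mult_right_mono) auto
      finally show "(\<Sum>i\<in>{..<n}-?S. \<integral>x. ?d x i \<partial>?M) \<le> n * (2 * exp (- t\<^sup>2 / 2))" .
    qed (use sp in auto)
    finally show ?thesis by (simp add: mult_ac)
  qed

  show ?thesis
    using FNR FDR integrable_FDP[OF proc, of \<theta>] integrable_FNP[OF proc, of \<theta>]
    by (simp add: risk_eq_integral[OF proc])
qed

section \<open>Limits\<close>

text \<open>With threshold \<open>\<alpha> + d\<close>, the identity exp(-\<alpha>^2/2) = s/n
  cancels the factor n/s in the false discovery term. The cross term of the square leaves
  \<open>exp (- d * \<alpha>)\<close>, and a signal clears the threshold with probability at least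
  \<open>p\<close>.\<close>

lemma minimax_risk_upper:
  fixes b :: real
  assumes s: "0 < s" "s \<le> n" and d: "0 < d"
  defines "\<alpha> \<equiv> signal_bound n s 0" and "p \<equiv> Phi_bar (d - b)"
  shows "minimax_risk n s b \<le> 1 - p + exp (- (s * p\<^sup>2) / 2) + 4 / p * exp (- d * \<alpha>)"
proof (rule minimax_risk_le[OF threshold_procedure_in_procedures s(2)])
  fix \<theta> assume \<theta>: "\<theta> \<in> Theta n s b"
  have \<alpha>0: "0 \<le> \<alpha>" using s by (simp add: \<alpha>_def signal_bound_def)
  have \<alpha>2: "\<alpha>\<^sup>2 = 2 * ln (n / s)" using s by (simp add: \<alpha>_def signal_bound_def)
  have p: "0 < p" by (simp add: p_def Phi_bar_pos)
  have "- (\<alpha> + d)\<^sup>2 / 2 = - \<alpha>\<^sup>2 / 2 - d * \<alpha> - d\<^sup>2 / 2"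
    by (simp add: power2_eq_square field_simps)
  then have "n * exp (- (\<alpha> + d)\<^sup>2 / 2) / s = (n / s) * (exp (- \<alpha>\<^sup>2 / 2) * exp (- d * \<alpha> - d\<^sup>2 / 2))"
    by (simp flip: exp_add)
  also have "exp (- \<alpha>\<^sup>2 / 2) = s / n"
    using s by (simp add: \<alpha>2 exp_minus)
  also have "n / s * (s / n * exp (- d * \<alpha> - d\<^sup>2 / 2)) = exp (- d * \<alpha> - d\<^sup>2 / 2)"
    using s by simp
  also have "\<dots> \<le> exp (- d * \<alpha>)" by simp
  finally have *: "n * exp (- (\<alpha> + d)\<^sup>2 / 2) / s \<le> exp (- d * \<alpha>)" .
  have gap: "\<alpha> + d - signal_bound n s b = d - b" by (simp add: \<alpha>_def signal_bound_def)
  have "risk n \<theta> (threshold_procedure n (\<alpha> + d))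
    \<le> 1 - p + exp (- (s * p\<^sup>2) / 2) + 4 * n * exp (- (\<alpha> + d)\<^sup>2 / 2) / (s * p)"
    using threshold_risk_le[OF \<theta> s(1), of "\<alpha> + d"] \<alpha>0 d unfolding gap p_def by simp
  also have "4 * n * exp (- (\<alpha> + d)\<^sup>2 / 2) / (s * p) = 4 / p * (n * exp (- (\<alpha> + d)\<^sup>2 / 2) / s)"
    by (simp add: mult_ac)
  also have "\<dots> \<le> 4 / p * exp (- d * \<alpha>)"
    using * p by (intro mult_left_mono) auto
  finally show "risk n \<theta> (threshold_procedure n (\<alpha> + d))
    \<le> 1 - p + exp (- (s * p\<^sup>2) / 2) + 4 / p * exp (- d * \<alpha>)" by simp
qed

text \<open>Takes \<open>T = \<alpha> - c\<close> and \<open>l = c\<close> in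
  \<open>minimax_risk_ge\<close>. One \<open>c\<close> is the linearization loss; the other,
  together with the logarithm, comes from shifting the argument of \<open>Phi_bar\<close> to
  \<open>- b\<close>.\<close>

lemma minimax_risk_lower:
  assumes s: "0 < s" "s \<le> n" and ns: "4 \<le> real n / real s" and c: "0 < c" "c \<le> 1"
  defines "\<alpha> \<equiv> signal_bound n s 0"
  assumes \<alpha>: "0 < \<alpha> + b" "c \<le> \<alpha>"
  shows "Phi_bar b - 2 * c + ln c / (\<alpha> + b)
      - exp (- (c / (4 * sqrt (2 * pi)) * exp (c / 2 * \<alpha> - c\<^sup>2 / 8))) \<le> minimax_risk n s b"
proof -
  define m where "m = n div s"
  have \<alpha>2: "\<alpha>\<^sup>2 = 2 * ln (n / s)" using s by (simp add: \<alpha>_def signal_bound_def)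
  then have e\<alpha>: "exp (\<alpha>\<^sup>2 / 2) = n / s" using s by simp
  have sb: "signal_bound n s b = \<alpha> + b" by (simp add: \<alpha>_def signal_bound_def)
  have "real n / real s < m + 1"
    using floor_divide_of_nat_eq[of n s, where 'a = real] floor_correct[of "real n / real s"] by (simp add: m_def)
  \<comment> \<open>From n/s < m + 1 and n/s >= 4 follows m - 1 > n/s - 2 >= n/(2s).\<close>
  then have m: "n / s / 2 \<le> real (m - 1)" using ns by (simp add: of_nat_diff)
  have tail: "(1 - Phi_bar (\<alpha> - c)) ^ (m - 1) \<le> exp (- (c / (4 * sqrt (2 * pi)) * exp (c / 2 * \<alpha> - c\<^sup>2 / 8)))"
  proof -
    have "(1 - Phi_bar (\<alpha> - c)) ^ (m - 1) \<le> exp (- Phi_bar (\<alpha> - c)) ^ (m - 1)"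
      using exp_ge_add_one_self[of "- Phi_bar (\<alpha> - c)"] Phi_bar_le_1 by (intro power_mono) auto
    also have "\<dots> = exp (- (real (m - 1) * Phi_bar (\<alpha> - c)))" by (simp flip: exp_of_nat_mult)
    also have "\<dots> \<le> exp (- (c / (4 * sqrt (2 * pi)) * exp (c / 2 * \<alpha> - c\<^sup>2 / 8)))"
    proof -
      \<comment> \<open>The window for the tail estimate is half of \<open>c\<close>, and
        \<alpha>^2/2 - (\<alpha> - c/2)^2/2 = c\<alpha>/2 - c^2/8.\<close>
      have "c / (4 * sqrt (2 * pi)) * exp (c / 2 * \<alpha> - c\<^sup>2 / 8)
          = exp (\<alpha>\<^sup>2 / 2) / 2 * (c / 2 * std_normal_density (\<alpha> - c + c / 2))"
        by (simp add: std_normal_density_def flip: exp_add) (simp add: power2_eq_square field_simps)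
      also have "\<dots> \<le> real (m - 1) * Phi_bar (\<alpha> - c)"
        using \<alpha> c m unfolding e\<alpha> by (intro mult_mono Phi_bar_ge_density) auto
      finally show ?thesis by simp
    qed
    finally show ?thesis .
  qed
  have "Phi_bar (\<alpha> - c + ln c / (\<alpha> + b) - (\<alpha> + b)) \<le> Phi_bar (- b) + (c - ln c / (\<alpha> + b))"
  proof -
    have "ln c / (\<alpha> + b) \<le> 0" using c \<alpha> by (simp add: divide_le_0_iff)
    then show ?thesis
      using Phi_bar_lipschitz[of "\<alpha> - c + ln c / (\<alpha> + b) - (\<alpha> + b)" "- b"] c by simp
  qed
  then show ?thesis
    using minimax_risk_ge[OF s _ c, of b "\<alpha> - c"] \<alpha>(1) tail
    unfolding sb m_def Phi_bar_minus by linarith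
qed

text \<open>In each finite-sample bound the margin, \<open>c\<close> or \<open>d\<close>, is fixed
  first according to the tolerance. Then \<open>n\<close> grows, and the remainders vanish because
  \<open>\<alpha>\<close> and \<open>s\<close> diverge.\<close>

lemma minimax_risk_tendsto:
  fixes s :: "nat \<Rightarrow> nat"
  assumes s_range: "\<And>n. n \<ge> 1 \<Longrightarrow> 1 \<le> s n \<and> s n \<le> n"
    and s_lim: "filterlim s at_top sequentially"
    and sparse: "filterlim (\<lambda>n. real n / real (s n)) at_top sequentially"
  shows "(\<lambda>n. minimax_risk n (s n) b) \<longlonglongrightarrow> Phi_bar b"
proof -
  define \<alpha> where "\<alpha> = (\<lambda>n. signal_bound n (s n) 0)"
  have "filterlim (\<lambda>x::real. sqrt (2 * ln x)) at_top at_top" by real_asymp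
  from filterlim_compose[OF this sparse] have \<alpha>: "filterlim \<alpha> at_top sequentially"
    by (simp add: \<alpha>_def signal_bound_def)
  have s_real: "filterlim (\<lambda>n. real (s n)) at_top sequentially"
    by (rule filterlim_compose[OF filterlim_real_sequentially s_lim])
  have ev_s: "\<forall>\<^sub>F n in sequentially. 0 < s n \<and> s n \<le> n"
    using eventually_ge_at_top[of 1] by eventually_elim (use s_range in force)
  have lower: "\<forall>\<^sub>F n in sequentially. l < minimax_risk n (s n) b" if l: "l < Phi_bar b" for l
  proof -
    \<comment> \<open>The lower bound loses \<open>2 * c\<close> in the limit, so a third of the gap
      leaves room; the cap at 1 meets the requirement \<open>c \<le> 1\<close>.\<close>
    define c where "c = min 1 ((Phi_bar b - l) / 3)"
    have c: "0 < c" "c \<le> 1" "l < Phi_bar b - 2 * c" using l by (auto simp: c_def min_def field_simps)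
    have "((\<lambda>x. Phi_bar b - 2 * c + ln c / (x + b)
        - exp (- (c / (4 * sqrt (2 * pi)) * exp (c / 2 * x - c\<^sup>2 / 8)))) \<longlongrightarrow> Phi_bar b - 2 * c + 0 - 0) at_top"
    proof (intro tendsto_intros)
      show "((\<lambda>x. ln c / (x + b)) \<longlongrightarrow> 0) at_top" by real_asymp
      have "0 < c / (4 * sqrt (2 * pi))" using c by simp
      then show "((\<lambda>x. exp (- (c / (4 * sqrt (2 * pi)) * exp (c / 2 * x - c\<^sup>2 / 8)))) \<longlongrightarrow> 0) at_top"
        using c(1) by real_asymp
    qed
    from filterlim_compose[OF this \<alpha>] c(3)
    have "\<forall>\<^sub>F n in sequentially. l < Phi_bar b - 2 * c + ln c / (\<alpha> n + b)
        - exp (- (c / (4 * sqrt (2 * pi)) * exp (c / 2 * \<alpha> n - c\<^sup>2 / 8)))"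
      by (intro order_tendstoD) auto
    moreover have "\<forall>\<^sub>F n in sequentially. 4 \<le> real n / real (s n)"
      using sparse by (simp add: filterlim_at_top)
    \<comment> \<open>Ensures both \<open>\<alpha> n + b \<ge> 1\<close> and
      \<open>c \<le> \<alpha> n\<close>.\<close>
    moreover have "\<forall>\<^sub>F n in sequentially. max (1 - b) c \<le> \<alpha> n"
      using \<alpha> unfolding filterlim_at_top by blast
    ultimately show ?thesis
      using ev_s
    proof eventually_elim
      case (elim n)
      then show ?case
        using minimax_risk_lower[of "s n" n c b] c by (simp add: \<alpha>_def)
    qed
  qed
  have upper: "\<forall>\<^sub>F n in sequentially. minimax_risk n (s n) b < u" if u: "Phi_bar b < u" for u
  proof -
    \<comment> \<open>Half of the gap, since the Lipschitz bound turns the margin \<open>d\<close>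
      into an excess of at most \<open>d\<close> over \<open>Phi_bar b\<close>.\<close>
    define d where "d = (u - Phi_bar b) / 2"
    define p where "p = Phi_bar (d - b)"
    have d: "0 < d" using u by (simp add: d_def)
    have p: "0 < p" by (simp add: p_def Phi_bar_pos)
    have "1 - p = Phi_bar (b - d)" using Phi_bar_minus[of "d - b"] by (simp add: p_def)
    also have "\<dots> \<le> Phi_bar b + d" using Phi_bar_lipschitz[of "b - d" b] d by simp
    also have "\<dots> < u" using u by (simp add: d_def field_simps)
    finally have pu: "1 - p < u" .
    have "((\<lambda>x::real. exp (- (x * p\<^sup>2) / 2)) \<longlongrightarrow> 0) at_top" using p by real_asymp
    moreover have "((\<lambda>x. exp (- d * x)) \<longlongrightarrow> 0) at_top" using d by real_asymp
    ultimately have "(\<lambda>n. 1 - p + exp (- (s n * p\<^sup>2) / 2) + 4 / p * exp (- d * \<alpha> n)) \<longlonglongrightarrow> 1 - p + 0 + 4 / p * 0"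
      by (intro tendsto_add tendsto_mult tendsto_const filterlim_compose[OF _ s_real] filterlim_compose[OF _ \<alpha>])
    then have "\<forall>\<^sub>F n in sequentially. 1 - p + exp (- (s n * p\<^sup>2) / 2) + 4 / p * exp (- d * \<alpha> n) < u"
      using pu by (intro order_tendstoD) auto
    then show ?thesis
      using ev_s
    proof eventually_elim
      case (elim n)
      then show ?case
        using minimax_risk_upper[of "s n" n d b] d by (simp add: \<alpha>_def p_def)
    qed
  qed
  show ?thesis by (rule order_tendstoI) (fact lower upper)+
qed

theorem theorem1:
  fixes s :: "nat \<Rightarrow> nat"
  assumes s_range: "\<And>n. n \<ge> 1 \<Longrightarrow> 1 \<le> s n \<and> s n \<le> n"
    and s_lim: "filterlim s at_top sequentially"
    and sparse: "filterlim (\<lambda>n. real n / real (s n)) at_top sequentially"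
  shows "(\<forall>b::real. (\<lambda>n. minimax_risk n (s n) b - Phi_bar b) \<in> o(\<lambda>_. 1))
    \<and> (\<forall>b::nat \<Rightarrow> real. filterlim b at_top sequentially \<longrightarrow>
          (\<lambda>n. minimax_risk n (s n) (b n) - Phi_bar (b n)) \<in> o(\<lambda>_. 1)
          \<and> (\<lambda>n. Phi_bar (b n)) \<longlonglongrightarrow> 0)
    \<and> (\<forall>b::nat \<Rightarrow> real. filterlim b at_bot sequentially \<longrightarrow>
          (\<lambda>n. minimax_risk n (s n) (b n) - Phi_bar (b n)) \<in> o(\<lambda>_. 1)
          \<and> (\<lambda>n. Phi_bar (b n)) \<longlonglongrightarrow> 1)"
proof (intro conjI allI impI)
  note lim = minimax_risk_tendsto[OF s_range s_lim sparse]
  have smalloI: "f \<in> o(\<lambda>_. 1)" if "f \<longlonglongrightarrow> 0" for f :: "nat \<Rightarrow> real"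
    using that by (intro smalloI_tendsto) auto
  have ev_s: "\<forall>\<^sub>F n in sequentially. 0 < s n \<and> s n \<le> n"
    using eventually_ge_at_top[of 1] by eventually_elim (use s_range in force)
  show "(\<lambda>n. minimax_risk n (s n) b - Phi_bar b) \<in> o(\<lambda>_. 1)" for b
    using tendsto_diff[OF lim tendsto_const[of "Phi_bar b"], of b] by (intro smalloI) simp
  {
    fix b :: "nat \<Rightarrow> real" assume b: "filterlim b at_top sequentially"
    show Phi: "(\<lambda>n. Phi_bar (b n)) \<longlonglongrightarrow> 0"
      by (rule filterlim_compose[OF Phi_bar_at_top b])
    have "(\<lambda>n. minimax_risk n (s n) (b n)) \<longlonglongrightarrow> 0"
    proof (rule order_tendstoI)
      fix u :: real assume "0 < u"
      then have "\<forall>\<^sub>F x in at_top. Phi_bar x < u"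
        using Phi_bar_at_top by (rule order_tendstoD(2)[rotated])
      \<comment> \<open>Eventually \<open>b n\<close> is at least this fixed \<open>x\<close>, so
        monotonicity compares with the fixed-level limit and stands in for uniformity in
        \<open>b\<close>.\<close>
      then obtain x where "Phi_bar x < u" by (auto simp: eventually_at_top_linorder)
      with lim have "\<forall>\<^sub>F n in sequentially. minimax_risk n (s n) x < u" by (rule order_tendstoD(2))
      moreover have "\<forall>\<^sub>F n in sequentially. x \<le> b n"
        using b unfolding filterlim_at_top by blast
      ultimately show "\<forall>\<^sub>F n in sequentially. minimax_risk n (s n) (b n) < u"
        using ev_s by eventually_elim (meson le_less_trans minimax_risk_antimono)
    next
      fix l :: real assume "l < 0"
      with ev_s show "\<forall>\<^sub>F n in sequentially. l < minimax_risk n (s n) (b n)"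
        by (elim eventually_mono) (meson less_le_trans minimax_risk_nonneg)
    qed
    from tendsto_diff[OF this Phi]
    show "(\<lambda>n. minimax_risk n (s n) (b n) - Phi_bar (b n)) \<in> o(\<lambda>_. 1)"
      by (intro smalloI) simp
  }
  {
    fix b :: "nat \<Rightarrow> real" assume b: "filterlim b at_bot sequentially"
    show Phi: "(\<lambda>n. Phi_bar (b n)) \<longlonglongrightarrow> 1"
      by (rule filterlim_compose[OF Phi_bar_at_bot b])
    have "(\<lambda>n. minimax_risk n (s n) (b n)) \<longlonglongrightarrow> 1"
    proof (rule order_tendstoI)
      fix l :: real assume "l < 1"
      then have "\<forall>\<^sub>F x in at_bot. l < Phi_bar x"
        using Phi_bar_at_bot by (rule order_tendstoD(1)[rotated])
      \<comment> \<open>Here \<open>b n\<close> eventually lies below the fixed \<open>x\<close>,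
        and monotonicity gives the comparison in the other direction.\<close>
      then obtain x where "l < Phi_bar x" by (auto simp: eventually_at_bot_linorder)
      with lim have "\<forall>\<^sub>F n in sequentially. l < minimax_risk n (s n) x" by (rule order_tendstoD(1))
      moreover have "\<forall>\<^sub>F n in sequentially. b n \<le> x"
        using b unfolding filterlim_at_bot by blast
      ultimately show "\<forall>\<^sub>F n in sequentially. l < minimax_risk n (s n) (b n)"
        using ev_s by eventually_elim (meson less_le_trans minimax_risk_antimono)
    next
      fix u :: real assume "1 < u"
      with ev_s show "\<forall>\<^sub>F n in sequentially. minimax_risk n (s n) (b n) < u"
        by (elim eventually_mono) (meson le_less_trans minimax_risk_le_1)
    qed
    from tendsto_diff[OF this Phi]
    show "(\<lambda>n. minimax_risk n (s n) (b n) - Phi_bar (b n)) \<in> o(\<lambda>_. 1)"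
      by (intro smalloI) simp
  }
qed

end
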